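(* Let $q=p^e\ge 3$ be a prime power, and let $\mathbb U_{S,\mathcal D}$ and $\mathbb U_{S',\mathcal D'}$ be affine $\mathrm{SL}(2,q)$-unitals. (a) If $\psi\colon\mathbb U_{S,\mathcal D}\to\mathbb U_{S',\mathcal D'}$ is an isomorphism, then $\psi=\alpha\rho_h$ (first $\alpha$, then $\rho_h$) for some $h\in\mathrm{SL}(2,q)$ and some $\alpha\in\mathfrak A$ with $S\cdot\alpha=S'$. (b) $\mathrm{Aut}(\mathbb U_{S,\mathcal D})\le \mathfrak A_S\ltimes R$.
   Context: Affine $\mathrm{SL}(2,q)$-unital: let $S\le\mathrm{SL}(2,q)$ be a subgroup of order $q+1$, let $\mathfrak P$ be the set of Sylow $p$-subgroups of $\mathrm{SL}(2,q)$, and let $\mathcal D$ be a collection of subsets of $\mathrm{SL}(2,q)$, each containing the identity $\mathbb 1$ and of size $q+1$, such that (Q) for each $D\in\mathcal D$ the set $D^*=\{xy^{-1}\mid x,y\in D,\ x\ne y\}$ has $q(q+1)$ elements, and (P) the sets $S\smallsetminus\{\mathbb 1\}$, $T\smallsetminus\{\mathbb 1\}$ for $T\in\mathfrak P$, and $D^*$ for $D\in\mathcal D$ form a partition of $\mathrm{SL}(2,q)\smallsetminus\{\mathbb 1\}$. Then $\mathbb U_{S,\mathcal D}$ is the incidence structure with point set $\mathrm{SL}(2,q)$, block set $\{Sg\}\cup\{Tg\mid T\in\mathfrak P\}\cup\{Dg\mid D\in\mathcal D\}$ ($g\in\mathrm{SL}(2,q)$), and containment as incidence. Isomorphisms are bijections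 of points mapping blocks onto blocks. Maps act on the right. $R=\{\rho_h\mid h\in\mathrm{SL}(2,q)\}$ with $\rho_h\colon x\mapsto xh$; $\mathfrak A$ is the group of permutations of $\mathrm{SL}(2,q)$ given by the group automorphisms of $\mathrm{SL}(2,q)$; $\mathfrak A_S=\{\alpha\in\mathfrak A\mid S\cdot\alpha=S\}$; $\mathfrak A_S\ltimes R$ denotes the group of permutations $\{\alpha\rho_h\mid \alpha\in\mathfrak A_S,\ h\in\mathrm{SL}(2,q)\}$ (note $\mathfrak A$ normalizes $R$). *)

theory Defs
  imports "HOL-Analysis.Determinants" "HOL-Algebra.Coset" "HOL-Algebra.Bij"
    "HOL-Computational_Algebra.Primes" "HOL-Library.Disjoint_Sets"
begin

text \<open>The field of order \<open>q\<close> is a type \<open>'a\<close> of classes \<open>field\<close> and \<open>finite\<close>, with \<open>q = CARD('a)\<close>.\<close>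

definition SL2 :: "('a::field^2^2) monoid"
  where "SL2 = \<lparr>carrier = {A. det A = 1}, mult = (**), one = mat 1\<rparr>"

lemma group_SL2: "group (SL2 :: ('a::field^2^2) monoid)"
proof (rule groupI)
  fix x :: "'a^2^2" assume "x \<in> carrier SL2"
  then have dx: "det x = 1" by (simp add: SL2_def)
  then obtain y where y: "x ** y = mat 1" "y ** x = mat 1"
    using invertible_det_nz[of x] by (auto simp: invertible_def)
  have "det y = 1" using det_mul[of x y] y dx by (simp add: det_I)
  then show "\<exists>y\<in>carrier SL2. y \<otimes>\<^bsub>SL2\<^esub> x = \<one>\<^bsub>SL2\<^esub>"
    using y by (auto simp: SL2_def)
qed (auto simp: SL2_def det_mul det_I matrix_mul_assoc matrix_mul_lid)

definition sylow_subgroups :: "nat \<Rightarrow> ('g, 'm) monoid_scheme \<Rightarrow> 'g set set"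
  where "sylow_subgroups p G = {T. subgroup T G \<and> card T = p ^ multiplicity p (order G)}"

definition quotients :: "('g, 'm) monoid_scheme \<Rightarrow> 'g set \<Rightarrow> 'g set"
  where "quotients G D = {x \<otimes>\<^bsub>G\<^esub> inv\<^bsub>G\<^esub> y | x y. x \<in> D \<and> y \<in> D \<and> x \<noteq> y}"

text \<open>Write \<open>D\<^sup>*\<close> for \<open>quotients SL2 D\<close>. The sets \<open>D\<^sup>*\<close> enter the partition as
  a family indexed by \<open>\<D>\<close>, so different members of
  \<open>\<D>\<close> have disjoint \<open>D\<^sup>*\<close>. Since \<^const>\<open>partition_on\<close> only sees the set of parts, the \<^const>\<open>inj_on\<close>
  conjunct excludes \<open>D\<^sup>* = D'\<^sup>*\<close> for \<open>D \<noteq> D'\<close>. No other parts can coincide, having different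
  sizes: \<open>q\<close> for \<open>S\<close>, \<open>q - 1\<close> for each \<open>T\<close>, and \<open>q (q + 1)\<close> for each \<open>D\<close>.\<close>

definition affine_SL2_unital :: "nat \<Rightarrow> ('a::{field,finite}^2^2) set \<Rightarrow> ('a^2^2) set set \<Rightarrow> bool"
  where "affine_SL2_unital p S \<D> \<longleftrightarrow>
    subgroup S SL2 \<and> card S = CARD('a) + 1 \<and>
    (\<forall>D\<in>\<D>. D \<subseteq> carrier SL2 \<and> \<one>\<^bsub>SL2\<^esub> \<in> D \<and> card D = CARD('a) + 1) \<and>
    (\<forall>D\<in>\<D>. card (quotients SL2 D) = CARD('a) * (CARD('a) + 1)) \<and>
    partition_on (carrier SL2 - {\<one>\<^bsub>SL2\<^esub>})
      ({S - {\<one>\<^bsub>SL2\<^esub>}} \<union> {T - {\<one>\<^bsub>SL2\<^esub>} | T. T \<in> sylow_subgroups p SL2}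
        \<union> quotients SL2 ` \<D>) \<and>
    inj_on (quotients SL2) \<D>"

text \<open>An incidence structure with containment as incidence: the pair of point set and block set.\<close>

type_synonym 'p incidence_structure = "'p set \<times> 'p set set"

definition SL2_unital ::
    "nat \<Rightarrow> ('a::{field,finite}^2^2) set \<Rightarrow> ('a^2^2) set set \<Rightarrow> ('a^2^2) incidence_structure"
  where "SL2_unital p S \<D> =
    (carrier SL2,
     {S #>\<^bsub>SL2\<^esub> g | g. g \<in> carrier SL2}
     \<union> {T #>\<^bsub>SL2\<^esub> g | T g. T \<in> sylow_subgroups p SL2 \<and> g \<in> carrier SL2}
     \<union> {D #>\<^bsub>SL2\<^esub> g | D g. D \<in> \<D> \<and> g \<in> carrier SL2})"

definition incidence_iso ::
    "'p incidence_structure \<Rightarrow> 'r incidence_structure \<Rightarrow> ('p \<Rightarrow> 'r) \<Rightarrow> bool"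
  where "incidence_iso U V \<psi> \<longleftrightarrow>
    bij_betw \<psi> (fst U) (fst V) \<and> (\<lambda>B. \<psi> ` B) ` snd U = snd V"

text \<open>Permutations of a set are extensional functions, as in \<^const>\<open>Bij\<close>.\<close>

definition incidence_Aut :: "'p incidence_structure \<Rightarrow> ('p \<Rightarrow> 'p) set"
  where "incidence_Aut U = {\<psi> \<in> extensional (fst U). incidence_iso U U \<psi>}"

definition right_translation :: "('g, 'm) monoid_scheme \<Rightarrow> 'g \<Rightarrow> 'g \<Rightarrow> 'g"
  where "right_translation G h = (\<lambda>x\<in>carrier G. x \<otimes>\<^bsub>G\<^esub> h)"

definition auto_stabilizer :: "('g, 'm) monoid_scheme \<Rightarrow> 'g set \<Rightarrow> ('g \<Rightarrow> 'g) set"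
  where "auto_stabilizer G S = {\<alpha> \<in> auto G. \<alpha> ` S = S}"

text \<open>\<open>\<AA>\<^sub>S \<ltimes> R\<close> as a permutation group: \<open>\<alpha>\<close> is applied first, then \<open>\<rho>\<^sub>h\<close>. The product of
  \<^const>\<open>BijGroup\<close> applies the right factor first, opposite to maps acting on the right; a
  group and its opposite have the same subgroups.\<close>

definition auto_translation_group :: "('g, 'm) monoid_scheme \<Rightarrow> 'g set \<Rightarrow> ('g \<Rightarrow> 'g) monoid"
  where "auto_translation_group G S = BijGroup (carrier G)
    \<lparr>carrier := {compose (carrier G) (right_translation G h) \<alpha> | \<alpha> h.
                  \<alpha> \<in> auto_stabilizer G S \<and> h \<in> carrier G}\<rparr>"

end

theory Submission
  imports Defs "HOL-Algebra.Group_Action" "HOL-Algebra.Generated_Groups"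
begin

text \<open>The blocks of size \<open>q\<close> are the cosets of the Sylow \<open>p\<close>-subgroups, which are the
  stabilizers of nonzero vectors. Any two points on a common short block have a quotient of trace
  \<open>2\<close>, and counting joining blocks tells whether two short blocks are left cosets of the same
  Sylow subgroup, or right cosets of the same one, or neither. Hence an isomorphism either preserves
  the two partitions into left and right cosets or interchanges them.

  If it preserves them and fixes \<open>1\<close>, then it intertwines the conjugation actions on the Sylow
  subgroups, so it is multiplicative up to sign; the sign is excluded when the second factor is
  unipotent, and unipotent elements generate. If it interchanges them, its composition with
  inversion is an automorphism of the group; but then all conjugates of a subgroup of order
  \<open>q + 1\<close> are blocks through \<open>1\<close>, which forces \<open>S'\<close> to be normal, and this is impossible for
  \<open>q \<ge> 3\<close>.\<close>

section \<open>Transvections and root subgroups of SL(2,q)\<close>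

no_notation subset_mset (infix \<open><#\<close> 50)

text \<open>The short blocks alone cannot determine the multiplication. As
  \<open>T g = g (g^-1 T g)\<close> and the Sylow subgroups are closed under conjugation, the right
  cosets of Sylow subgroups are also the left cosets, and inversion permutes them. So the two coset
  partitions can only be recovered up to interchange, and the translates of S, which inversion turns
  into left cosets, must decide between the two cases. The partitions come from two coordinates of a
  short block \<open>x T\<close>: the Sylow subgroups \<open>x T x^-1\<close> and \<open>T\<close>.
  By transitivity of conjugation all pairs occur, so the short blocks cover a square grid, and the
  joining criterion says when two of them share a row or a column. The sign ambiguity has its origin
  in the centre: conjugation does not distinguish g from -g.\<close>

definition mat2 :: "'a \<Rightarrow> 'a \<Rightarrow> 'a \<Rightarrow> 'a \<Rightarrow> 'a::zero^2^2"
  where "mat2 a b c d = vector [vector [a, b], vector [c, d]]"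

lemma mat2_nth [simp]:
  "mat2 a b c d $ 1 $ 1 = a" "mat2 a b c d $ 1 $ 2 = b"
  "mat2 a b c d $ 2 $ 1 = c" "mat2 a b c d $ 2 $ 2 = d"
  by (simp_all add: mat2_def)

lemma mat2_cases:
  fixes A :: "'a::zero^2^2"
  obtains a b c d where "A = mat2 a b c d"
proof
  show "A = mat2 (A $ 1 $ 1) (A $ 1 $ 2) (A $ 2 $ 1) (A $ 2 $ 2)"
    by (simp add: vec_eq_iff forall_2)
qed

lemma mat2_eq_iff [simp]:
  "mat2 a b c d = mat2 a' b' c' d' \<longleftrightarrow> a = a' \<and> b = b' \<and> c = c' \<and> d = d'"
  by (metis mat2_nth)

lemma mat2_mult:
  fixes a :: "'a::semiring_1"
  shows "mat2 a b c d ** mat2 a' b' c' d'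
    = mat2 (a * a' + b * c') (a * b' + b * d') (c * a' + d * c') (c * b' + d * d')"
  by (simp add: vec_eq_iff forall_2 matrix_matrix_mult_def sum_2)

lemma mat2_mult_vec:
  fixes a :: "'a::semiring_1"
  shows "mat2 a b c d *v vector [x, y] = vector [a * x + b * y, c * x + d * y]"
  by (simp add: vec_eq_iff forall_2 matrix_vector_mult_def sum_2)

lemma mat_1_eq_mat2: "(mat 1 :: 'a::semiring_1^2^2) = mat2 1 0 0 1"
  by (simp add: vec_eq_iff forall_2 mat_def)

lemma mat2_in_SL2: "mat2 a b c d \<in> carrier SL2 \<longleftrightarrow> a * d - b * c = (1::'a::field)"
  by (simp add: SL2_def det_2)

lemma SL2_cases:
  fixes A :: "'a::field^2^2"
  assumes "A \<in> carrier SL2"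
  obtains a b c d where "A = mat2 a b c d" "a * d - b * c = 1"
  by (metis assms mat2_cases mat2_in_SL2)

lemma SL2_mult: "A \<otimes>\<^bsub>SL2\<^esub> B = A ** (B :: 'a::field^2^2)"
  by (simp add: SL2_def)

lemma SL2_one: "\<one>\<^bsub>SL2\<^esub> = mat2 1 0 0 (1 :: 'a::field)"
  by (simp add: SL2_def mat_1_eq_mat2)

lemma SL2_inv:
  assumes "a * d - b * c = (1::'a::field)"
  shows "inv\<^bsub>SL2\<^esub> mat2 a b c d = mat2 d (- b) (- c) a"
proof (rule group.inv_equality[OF group_SL2])
  show "mat2 d (- b) (- c) a \<otimes>\<^bsub>SL2\<^esub> mat2 a b c d = \<one>\<^bsub>SL2\<^esub>"
    using assms by (simp add: SL2_mult SL2_one mat2_mult algebra_simps)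
qed (use assms in \<open>simp_all add: mat2_in_SL2 algebra_simps\<close>)

lemmas SL2_simps = SL2_mult SL2_one SL2_inv mat2_mult mat2_in_SL2

text \<open>The transvections \<open>1 + t v (J v)\<^sup>T\<close> fixing the vector \<open>v = (a, b)\<close>, with
  \<open>J v = (- b, a)\<close>.\<close>

definition transvection :: "'a::comm_ring_1 \<Rightarrow> 'a \<Rightarrow> 'a \<Rightarrow> 'a^2^2"
  where "transvection a b t = mat2 (1 - t * a * b) (t * a * a) (- (t * b * b)) (1 + t * a * b)"

definition root_subgroup :: "'a::comm_ring_1 \<Rightarrow> 'a \<Rightarrow> ('a^2^2) set"
  where "root_subgroup a b = range (transvection a b)"

text \<open>The zero vector is excluded because all its transvections are the identity. Proportional
  vectors give the same member, so the members correspond to the points of the projective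
  line.\<close>

definition root_subgroups :: "('a::comm_ring_1^2^2) set set"
  where "root_subgroups = {root_subgroup a b | a b. (a, b) \<noteq> (0, 0)}"

lemma transvection_in_SL2 [simp]: "transvection a b t \<in> carrier SL2"
  by (simp add: transvection_def mat2_in_SL2 algebra_simps)

lemma transvection_mult:
  "transvection a b s \<otimes>\<^bsub>SL2\<^esub> transvection a b t = transvection a b (s + t)"
  by (simp add: transvection_def SL2_simps algebra_simps)

lemma transvection_0: "transvection a b 0 = \<one>\<^bsub>SL2\<^esub>"
  by (simp add: transvection_def SL2_simps)

lemma transvection_inv: "inv\<^bsub>SL2\<^esub> transvection a b t = transvection a b (- t)"
  by (rule group.inv_equality[OF group_SL2]) (simp_all add: transvection_mult transvection_0)

lemma transvection_eq_iff:
  assumes "(a, b) \<noteq> (0, 0::'a::field)"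
  shows "transvection a b s = transvection a b t \<longleftrightarrow> s = t"
  using assms by (auto simp: transvection_def)

lemma subgroup_root_subgroup: "subgroup (root_subgroup a b) SL2"
proof (rule group.subgroupI[OF group_SL2])
  show "root_subgroup a b \<subseteq> carrier SL2" "root_subgroup a b \<noteq> {}"
    by (auto simp: root_subgroup_def)
next
  fix x y
  assume "x \<in> root_subgroup a b" "y \<in> root_subgroup a b"
  then show "inv\<^bsub>SL2\<^esub> x \<in> root_subgroup a b" "x \<otimes>\<^bsub>SL2\<^esub> y \<in> root_subgroup a b"
    by (auto simp: root_subgroup_def transvection_mult transvection_inv)
qed

lemma card_root_subgroup:
  assumes "(a, b) \<noteq> (0, 0::'a::{field,finite})"
  shows "card (root_subgroup a b) = CARD('a)"
  unfolding root_subgroup_def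
  by (rule card_image) (use transvection_eq_iff[OF assms] in \<open>auto simp: inj_on_def\<close>)

lemma card_root_subgroups:
  fixes T :: "('a::{field,finite}^2^2) set"
  shows "T \<in> root_subgroups \<Longrightarrow> card T = CARD('a)"
  by (auto simp: root_subgroups_def card_root_subgroup)

lemma subgroup_root_subgroups: "T \<in> root_subgroups \<Longrightarrow> subgroup T (SL2 :: ('a::field^2^2) monoid)"
  by (auto simp: root_subgroups_def subgroup_root_subgroup)

text \<open>A matrix of determinant 1 with a nonzero fixed vector has trace 2. Trace and fixed
  vector leave one free entry, which gives the parameter: \<open>l / a^2\<close> if a is nonzero,
  \<open>- m / b^2\<close> otherwise.\<close>

lemma mem_root_subgroup_iff:
  assumes "(a, b) \<noteq> (0, 0::'a::field)" "k * n - l * m = 1"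
  shows "mat2 k l m n \<in> root_subgroup a b \<longleftrightarrow> k * a + l * b = a \<and> m * a + n * b = b"
proof
  assume "mat2 k l m n \<in> root_subgroup a b"
  then show "k * a + l * b = a \<and> m * a + n * b = b"
    by (auto simp: root_subgroup_def transvection_def ring_distribs mult_ac)
next
  assume eq: "k * a + l * b = a \<and> m * a + n * b = b"
  have tr: "k + n = 1 + 1"
  proof (cases "a = 0")
    case True
    then have "l = 0" "n = 1" using eq assms by auto
    then show ?thesis using assms by simp
  next
    case False
    \<comment> \<open>This is the adjugate applied to the fixed vector. Adding
      \<open>n a - l b = a\<close> to \<open>k a + l b = a\<close> cancels \<open>l b\<close> and
      leaves a times the trace.\<close>
    have "n * (k * a + l * b) - l * (m * a + n * b) = (k * n - l * m) * a"
      by (simp add: algebra_simps)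
    then have "n * a - l * b = a" "k * a + l * b = a" using eq assms(2) by simp_all
    then have "a * (k + n) = a + a" by (simp add: algebra_simps)
    then have "a * (k + n) = a * (1 + 1)" by (simp only: ring_distribs mult_1_right)
    then show ?thesis using False by (simp only: mult_cancel_left simp_thms)
  qed
  show "mat2 k l m n \<in> root_subgroup a b"
  proof (cases "a = 0")
    case True
    with eq assms tr have "l = 0" "n = 1" "k = 1" by auto
    then have "mat2 k l m n = transvection a b (- (m / (b * b)))"
      using True assms by (simp add: transvection_def)
    then show ?thesis by (auto simp: root_subgroup_def)
  next
    case False
    have n: "n = 1 + 1 - k" using tr by (metis add_diff_cancel_left')
    have k: "l / (a * a) * a * b = 1 - k" using eq False by (simp add: field_simps)
    have "m * a + b = k * b" "k * a = a - l * b" using eq n by (auto simp: algebra_simps)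
    then have "a * m * a = - (l * b * b)" by algebra
    then have "m = - (l / (a * a) * b * b)" using False by (simp add: field_simps)
    then have "mat2 k l m n = transvection a b (l / (a * a))"
      using False k n by (simp add: transvection_def)
    then show ?thesis by (auto simp: root_subgroup_def)
  qed
qed

text \<open>For g of determinant 1 the row \<open>(J v)^T g^-1\<close> equals
  \<open>(J (g v))^T\<close>, so conjugation merely replaces v by \<open>g v\<close> and keeps the
  parameter t.\<close>

lemma transvection_conj:
  assumes "k * n - l * m = (1::'a::field)"
  shows "mat2 k l m n \<otimes>\<^bsub>SL2\<^esub> transvection a b t \<otimes>\<^bsub>SL2\<^esub> inv\<^bsub>SL2\<^esub> mat2 k l m n
    = transvection (k * a + l * b) (m * a + n * b) t"
proof -
  let ?x = "k * a + l * b" and ?y = "m * a + n * b"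
  let ?A = "k * (1 - t * a * b) + l * - (t * b * b)" and ?B = "k * (t * a * a) + l * (1 + t * a * b)"
  let ?C = "m * (1 - t * a * b) + n * - (t * b * b)" and ?D = "m * (t * a * a) + n * (1 + t * a * b)"
  have "?A * n + ?B * - m = 1 - t * ?x * ?y" "?A * - l + ?B * k = t * ?x * ?x"
    "?C * n + ?D * - m = - (t * ?y * ?y)" "?C * - l + ?D * k = 1 + t * ?x * ?y"
    using assms by algebra+
  then show ?thesis
    unfolding transvection_def SL2_inv[OF assms] SL2_mult mat2_mult by (simp only:)
qed

lemma root_subgroup_conj:
  assumes "k * n - l * m = (1::'a::field)"
  shows "mat2 k l m n <#\<^bsub>SL2\<^esub> root_subgroup a b #>\<^bsub>SL2\<^esub> inv\<^bsub>SL2\<^esub> mat2 k l m n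
    = root_subgroup (k * a + l * b) (m * a + n * b)"
  unfolding root_subgroup_def l_coset_def r_coset_def
  by (auto simp: transvection_conj[OF assms, symmetric])

lemma root_subgroup_eq_iff:
  assumes "(a, b) \<noteq> (0, 0::'a::field)" "(c, d) \<noteq> (0, 0)"
  shows "root_subgroup a b = root_subgroup c d \<longleftrightarrow> a * d = b * c"
proof
  assume "root_subgroup a b = root_subgroup c d"
  \<comment> \<open>The transvection with t = 1 moves (c, d) by \<open>a d - b c\<close> times (a,
    b), so it fixes (c, d) only if the two vectors are proportional.\<close>
  then have "transvection a b 1 \<in> root_subgroup c d" by (auto simp: root_subgroup_def)
  then have eq: "(1 - a * b) * c + a * a * d = c" "- (b * b) * c + (1 + a * b) * d = d"
    using assms mem_root_subgroup_iff[of c d "1 - a * b" "1 + a * b" "a * a" "- (b * b)"]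
    by (auto simp: transvection_def algebra_simps)
  have "a * (a * d - b * c) = 0" "b * (a * d - b * c) = 0"
    using eq by (simp_all add: algebra_simps)
  then show "a * d = b * c" using assms(1) by auto
next
  assume eq: "a * d = b * c"
  obtain r where r: "a = r * c" "b = r * d"
  proof (cases "c = 0")
    case True
    then show ?thesis using eq assms that[of "b / d"] by auto
  next
    case False
    then show ?thesis using eq that[of "a / c"] by (auto simp: field_simps)
  qed
  then have "r \<noteq> 0" using assms by auto
  have "transvection a b t = transvection c d (r * r * t)" for t
    by (simp add: r transvection_def algebra_simps)
  moreover have "transvection c d t = transvection a b (t / (r * r))" for t
    using \<open>r \<noteq> 0\<close> by (simp add: r transvection_def algebra_simps)
  ultimately show "root_subgroup a b = root_subgroup c d"
    unfolding root_subgroup_def by (intro equalityI image_subsetI) (metis rangeI)+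
qed

lemma SL2_apply_nonzero:
  assumes "k * n - l * m = (1::'a::field)" "(a, b) \<noteq> (0, 0)"
  shows "(k * a + l * b, m * a + n * b) \<noteq> (0, 0)"
proof
  assume "(k * a + l * b, m * a + n * b) = (0, 0)"
  then have "k * a + l * b = 0" "m * a + n * b = 0" by auto
  then have "a = 0" "b = 0" using assms(1) by algebra+
  then show False using assms(2) by simp
qed

lemma root_subgroups_conj_closed:
  assumes "g \<in> carrier (SL2 :: ('a::field^2^2) monoid)" "T \<in> root_subgroups"
  shows "g <#\<^bsub>SL2\<^esub> T #>\<^bsub>SL2\<^esub> inv\<^bsub>SL2\<^esub> g \<in> root_subgroups"
  using assms root_subgroup_conj SL2_apply_nonzero unfolding root_subgroups_def
  by (elim SL2_cases) blast

text \<open>Already the nonzero vectors form one orbit: one matrix takes (a, b) to (1, 0), another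
  has first column (c, d), and their product does the rest.\<close>

lemma root_subgroups_conj_transitive:
  assumes "T \<in> root_subgroups" "U \<in> root_subgroups"
  obtains g where "g \<in> carrier (SL2 :: ('a::field^2^2) monoid)"
    "g <#\<^bsub>SL2\<^esub> T #>\<^bsub>SL2\<^esub> inv\<^bsub>SL2\<^esub> g = U"
proof -
  have to: "\<exists>k l m n. k * n - l * m = 1 \<and> k * a + l * b = c \<and> m * a + n * b = d"
    if ab: "(a, b) \<noteq> (0, 0)" and cd: "(c, d) \<noteq> (0, 0::'a)" for a b c d
  proof -
    have *: "\<exists>k l m n. k * n - l * m = 1 \<and> k * a + l * b = 1 \<and> m * a + n * b = 0"
    proof (cases "a = 0")
      case True
      with ab show ?thesis by (intro exI[of _ 0] exI[of _ "1/b"] exI[of _ "-b"]) auto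
    next
      case False
      then show ?thesis
        by (intro exI[of _ "1/a"] exI[of _ 0] exI[of _ "-b"] exI[of _ a]) auto
    qed
    have "\<exists>k l m n. k * n - l * m = 1 \<and> k = c \<and> m = d"
    proof (cases "c = 0")
      case True
      with cd show ?thesis by (intro exI[of _ 0] exI[of _ "-1/d"] exI[of _ d]) auto
    next
      case False
      then show ?thesis
        by (intro exI[of _ c] exI[of _ 0] exI[of _ d] exI[of _ "1/c"]) auto
    qed
    then obtain l n where cd': "c * n - l * d = 1" by blast
    obtain k' l' m' n' where
      e: "k' * n' - l' * m' = 1" "k' * a + l' * b = 1" "m' * a + n' * b = 0"
      using * by blast
    have "(c * k' + l * m') * (d * l' + n * n') - (c * l' + l * n') * (d * k' + n * m') = 1"
      "(c * k' + l * m') * a + (c * l' + l * n') * b = c"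
      "(d * k' + n * m') * a + (d * l' + n * n') * b = d"
      using e cd' by algebra+
    then show ?thesis by blast
  qed
  from assms obtain a b c d where
    T: "T = root_subgroup a b" "(a, b) \<noteq> (0, 0)" and U: "U = root_subgroup c d" "(c, d) \<noteq> (0, 0)"
    by (auto simp: root_subgroups_def)
  obtain k l m n where "k * n - l * m = 1" "k * a + l * b = c" "m * a + n * b = d"
    using to[OF T(2) U(2)] by blast
  then show ?thesis
    using that[of "mat2 k l m n"] by (simp add: T U root_subgroup_conj mat2_in_SL2)
qed

text \<open>Normalizing every root subgroup means fixing every line, which makes g scalar, and 1 is
  the only unipotent scalar. In coordinates, a transvection moves w = (c, d) by
  \<open>t (a d - b c)\<close> times (a, b), which is parallel to w only if
  \<open>t (a d - b c)^2 = 0\<close>; the two unit vectors w suffice.\<close>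

lemma root_subgroup_normalizing_all_trivial:
  assumes "T \<in> root_subgroups" "g \<in> T"
    and "\<And>U. U \<in> root_subgroups \<Longrightarrow> g <#\<^bsub>SL2\<^esub> U #>\<^bsub>SL2\<^esub> inv\<^bsub>SL2\<^esub> g = U"
  shows "g = \<one>\<^bsub>SL2 :: ('a::field^2^2) monoid\<^esub>"
proof -
  obtain a b t where T: "(a, b) \<noteq> (0, 0)" "g = transvection a b t"
    using assms by (auto simp: root_subgroups_def root_subgroup_def)
  have fix_dir: "t * (a * d - b * c) * (a * d - b * c) = 0" if cd: "(c, d) \<noteq> (0, 0)" for c d
  proof -
    have det1: "(1 - t * a * b) * (1 + t * a * b) - (t * a * a) * (- (t * b * b)) = 1"
      by (simp add: algebra_simps)
    have "root_subgroup c d \<in> root_subgroups" using cd by (auto simp: root_subgroups_def)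
    then have "root_subgroup ((1 - t * a * b) * c + (t * a * a) * d)
        ((- (t * b * b)) * c + (1 + t * a * b) * d) = root_subgroup c d"
      using assms(3) root_subgroup_conj[OF det1] unfolding T transvection_def by metis
    then have "((1 - t * a * b) * c + (t * a * a) * d) * d
        = ((- (t * b * b)) * c + (1 + t * a * b) * d) * c"
      using root_subgroup_eq_iff[OF SL2_apply_nonzero[OF det1 cd] cd] by simp
    then show ?thesis by (simp add: algebra_simps)
  qed
  have "t * a * a = 0" "t * b * b = 0"
    using fix_dir[of 0 1] fix_dir[of 1 0] by simp_all
  then have "t = 0" using T(1) by auto
  then show ?thesis by (simp add: T transvection_0)
qed

text \<open>Determinant 1 and trace 2 make 1 an eigenvalue. The vector (l, 1 - k) solves the first
  row, and the determinant then yields the second; it is zero only if the first row is (1, 0), and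
  in that case (0, 1) is fixed.\<close>

lemma in_some_root_subgroup_iff_trace:
  assumes "k * n - l * m = (1::'a::field)"
  shows "mat2 k l m n \<in> \<Union>root_subgroups \<longleftrightarrow> k + n = 1 + 1"
proof
  assume "mat2 k l m n \<in> \<Union>root_subgroups"
  then show "k + n = 1 + 1"
    by (auto simp: root_subgroups_def root_subgroup_def transvection_def)
next
  assume tr: "k + n = 1 + 1"
  have "\<exists>a b. (a, b) \<noteq> (0, 0) \<and> k * a + l * b = a \<and> m * a + n * b = b"
  proof (cases "l = 0 \<and> k = 1")
    case True
    then show ?thesis using tr by (intro exI[of _ 0] exI[of _ 1]) auto
  next
    case False
    have n: "n = 1 + 1 - k" using tr by (metis add_diff_cancel_left')
    have "k * (1 + 1 - k) - l * m = 1" using assms n by simp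
    then have "m * l + (1 + 1 - k) * (1 - k) = 1 - k" by algebra
    then have "k * l + l * (1 - k) = l" "m * l + n * (1 - k) = 1 - k"
      by (simp_all add: n algebra_simps)
    then show ?thesis using False by (intro exI[of _ l] exI[of _ "1 - k"]) auto
  qed
  then obtain a b where ab: "(a, b) \<noteq> (0, 0)" "k * a + l * b = a" "m * a + n * b = b"
    by blast
  then have "mat2 k l m n \<in> root_subgroup a b" using mem_root_subgroup_iff assms by blast
  then show "mat2 k l m n \<in> \<Union>root_subgroups"
    using ab(1) unfolding root_subgroups_def by blast
qed

text \<open>A matrix with nonzero lower left entry is a product upper, lower, upper of unitriangular
  matrices. If that entry is 0, adding the first row to the second produces the nonzero entry
  k.\<close>

lemma SL2_generated_by_root_subgroups:
  "generate SL2 (\<Union>root_subgroups) = carrier (SL2 :: ('a::field^2^2) monoid)"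
proof
  show "generate SL2 (\<Union>root_subgroups) \<subseteq> carrier (SL2 :: ('a^2^2) monoid)"
    by (rule group.generate_incl[OF group_SL2])
      (auto simp: root_subgroups_def root_subgroup_def)
next
  let ?H = "generate SL2 (\<Union>root_subgroups) :: ('a^2^2) set"
  have tv: "mat2 k l m n \<in> ?H" if "k * n - l * m = 1" "k + n = 1 + 1" for k l m n
    using in_some_root_subgroup_iff_trace that by (blast intro: generate.incl)
  have mult: "A ** B \<in> ?H" if "A \<in> ?H" "B \<in> ?H" for A B
    using generate.eng[OF that] by (simp add: SL2_mult)
  have big: "mat2 k l m n \<in> ?H" if "k * n - l * m = 1" "m \<noteq> 0" for k l m n
  proof -
    have "mat2 k l m n
      = mat2 1 ((k - 1) / m) 0 1 ** mat2 1 0 m 1 ** mat2 1 ((n - 1) / m) 0 1"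
      using that by (simp add: mat2_mult field_simps)
    then show ?thesis using tv mult by (simp add: tv mult)
  qed
  have "mat2 k l m n \<in> ?H" if det1: "k * n - l * m = 1" for k l m n
  proof (cases "m = 0")
    case True
    with det1 have "k \<noteq> 0" by auto
    have "mat2 k l m n = mat2 1 0 (- 1) 1 ** mat2 k l (m + k) (n + l)"
      by (simp add: mat2_mult)
    moreover have "mat2 k l (m + k) (n + l) \<in> ?H"
      using big[of k "n + l" l "m + k"] det1 True \<open>k \<noteq> 0\<close> by (simp add: algebra_simps)
    ultimately show ?thesis using tv mult by (simp add: tv mult)
  qed (use big det1 in blast)
  then show "carrier SL2 \<subseteq> ?H" by (metis SL2_cases subsetI)
qed

section \<open>The Sylow subgroups\<close>

text \<open>Orbit sizes are powers of p. Without a singleton orbit each is divisible by p, and so is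
  their sum.\<close>

lemma (in group_action) p_group_fixed_point:
  assumes "prime p" "order G = p ^ n" "finite E" "\<not> p dvd card E"
  shows "\<exists>x\<in>E. \<forall>g\<in>carrier G. \<phi> g x = x"
proof (rule ccontr)
  assume no_fix: "\<not> ?thesis"
  have orb: "p dvd card C" if C: "C \<in> orbits G E \<phi>" for C
  proof -
    obtain x where x: "x \<in> E" "C = orbit G \<phi> x"
      using C by (auto simp: orbits_def)
    have "card C dvd p ^ n"
      using orbit_stabilizer_theorem[OF x(1)] assms(2) x(2) by (metis dvd_triv_left)
    then obtain k where k: "card C = p ^ k"
      using assms(1) by (auto simp: divides_primepow_nat)
    show ?thesis
    proof (cases k)
      case 0
      then have "card C = 1" using k by simp
      moreover have "x \<in> C" using orbit_refl[OF x(1)] x(2) by simp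
      ultimately have "C = {x}" by (metis card_1_singletonE singletonD)
      then have "\<forall>g\<in>carrier G. \<phi> g x = x" using x(2) by (auto simp: orbit_def)
      then show ?thesis using no_fix x(1) by blast
    qed (simp add: k)
  qed
  have "card E = (\<Sum>C\<in>orbits G E \<phi>. card C)"
    using disjoint_sum[OF assms(3), of "\<lambda>_. 1 :: nat"] by simp
  then have "p dvd card E" using orb by (simp add: dvd_sum)
  then show False using assms(4) by simp
qed

text \<open>Leaving out the zero vector makes the number of points prime to p and a fixed point
  informative. The maps are restricted because \<open>BijGroup\<close> consists of extensional
  functions.\<close>

lemma SL2_action_nonzero_vectors:
  "group_action SL2 {v. v \<noteq> 0} (\<lambda>A. \<lambda>v\<in>{v. v \<noteq> 0}. A *v (v :: 'a::field^2))"
proof -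
  let ?E = "{v. v \<noteq> 0} :: ('a^2) set" and ?phi = "\<lambda>A. \<lambda>v\<in>{v. v \<noteq> 0}. A *v (v :: 'a^2)"
  interpret SL2: group "SL2 :: ('a^2^2) monoid" by (rule group_SL2)
  have inv: "(inv\<^bsub>SL2\<^esub> A) *v (A *v v) = v" "A *v ((inv\<^bsub>SL2\<^esub> A) *v v) = v"
    if "A \<in> carrier SL2" for A :: "'a^2^2" and v
    using SL2.l_inv[OF that] SL2.r_inv[OF that]
    by (simp_all add: matrix_vector_mul_assoc SL2_def)
  have nz: "A *v v \<noteq> 0" if "A \<in> carrier SL2" "v \<noteq> 0" for A :: "'a^2^2" and v
    using inv(1)[OF that(1), of v] that(2) by force
  have Bij: "?phi A \<in> Bij ?E" if "A \<in> carrier SL2" for A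
  proof -
    have "bij_betw (?phi A) ?E ?E"
      by (rule bij_betw_byWitness[where f' = "?phi (inv\<^bsub>SL2\<^esub> A)"])
        (use that in \<open>auto simp: inv nz\<close>)
    then show ?thesis by (simp add: Bij_def)
  qed
  have "?phi (A \<otimes>\<^bsub>SL2\<^esub> B) = ?phi A \<otimes>\<^bsub>BijGroup ?E\<^esub> ?phi B"
    if "A \<in> carrier SL2" "B \<in> carrier SL2" for A B
    using that by (auto simp: BijGroup_def Bij compose_def nz SL2_mult matrix_vector_mul_assoc)
  then have "?phi \<in> hom SL2 (BijGroup ?E)"
    using Bij by (intro homI) (auto simp: BijGroup_def)
  then show ?thesis
    by (intro group_action.intro group_hom.intro group_hom_axioms.intro group_SL2 group_BijGroup)
qed

lemma card_nonzero_vectors: "card {v :: 'a::{field,finite}^2. v \<noteq> 0} = CARD('a) ^ 2 - 1"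
proof -
  have "{v :: 'a^2. v \<noteq> 0} = UNIV - {0}" by auto
  then show ?thesis by (simp add: card_Diff_singleton)
qed

lemma SL2_vec_fixers:
  assumes "(a, b) \<noteq> (0, 0)" "A \<in> carrier SL2"
  shows "A *v vector [a, b] = vector [a, b] \<longleftrightarrow> A \<in> root_subgroup a (b :: 'a::field)"
proof -
  obtain k l m n where "A = mat2 k l m n" "k * n - l * m = 1" using assms(2) by (rule SL2_cases)
  then show ?thesis
    using mem_root_subgroup_iff[OF assms(1)] by (auto simp: mat2_mult_vec) (metis vector_2)+
qed

text \<open>Orbit-stabilizer at the vector (1, 0): its orbit is all nonzero vectors, its stabilizer
  \<open>root_subgroup 1 0\<close>.\<close>

lemma order_SL2: "order (SL2 :: ('a::{field,finite}^2^2) monoid) = CARD('a) * (CARD('a) ^ 2 - 1)"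
proof -
  let ?E = "{v. v \<noteq> 0} :: ('a^2) set" and ?phi = "\<lambda>A. \<lambda>v\<in>{v. v \<noteq> 0}. A *v (v :: 'a^2)"
  interpret group_action "SL2 :: ('a^2^2) monoid" ?E ?phi by (rule SL2_action_nonzero_vectors)
  let ?e = "vector [1, 0] :: 'a^2"
  have e: "?e \<in> ?E" by (simp add: vec_eq_iff forall_2)
  have "v \<in> orbit SL2 ?phi ?e" if "v \<in> ?E" for v
  proof -
    have "\<exists>b d. v $ 1 * d - b * v $ 2 = 1"
    proof (cases "v $ 1 = 0")
      case True
      then have "v $ 2 \<noteq> 0" using that by (auto simp: vec_eq_iff forall_2)
      with True show ?thesis by (intro exI[of _ "- 1 / v $ 2"]) auto
    next
      case False
      then show ?thesis by (intro exI[of _ 0] exI[of _ "1 / v $ 1"]) auto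
    qed
    then obtain b d where "v $ 1 * d - b * v $ 2 = 1" by blast
    then have "mat2 (v $ 1) b (v $ 2) d \<in> carrier SL2" by (simp add: mat2_in_SL2)
    moreover have "?phi (mat2 (v $ 1) b (v $ 2) d) ?e = v"
      using e by (simp add: mat2_mult_vec vec_eq_iff forall_2)
    ultimately show ?thesis unfolding orbit_def by (metis (mono_tags, lifting) mem_Collect_eq)
  qed
  moreover have "orbit SL2 ?phi ?e \<subseteq> ?E" using e element_image by (auto simp: orbit_def)
  ultimately have "orbit SL2 ?phi ?e = ?E" by blast
  moreover have "stabilizer SL2 ?phi ?e = root_subgroup 1 0"
    using e SL2_vec_fixers[of 1 0] subgroup.subset[OF subgroup_root_subgroup[of 1 "0::'a"]]
    by (auto simp: stabilizer_def)
  ultimately show ?thesis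
    using orbit_stabilizer_theorem[OF e]
    by (simp add: card_nonzero_vectors card_root_subgroup mult.commute)
qed

text \<open>Since p does not divide \<open>q^2 - 1\<close>, the Sylow order is q, and a subgroup of
  order q has a common nonzero fixed vector. It lies in the stabilizer of that vector, which has the
  same order.\<close>

lemma sylow_subgroups_SL2:
  assumes "prime p" "CARD('a::{field,finite}) = p ^ e"
  shows "sylow_subgroups p (SL2 :: ('a^2^2) monoid) = root_subgroups"
proof -
  have q2: "CARD('a) \<ge> 2"
    using card_mono[of UNIV "{0, 1 :: 'a}"] by simp
  \<comment> \<open>A field has at least two elements. Only with \<open>e > 0\<close> does p divide
    q, and hence not \<open>q^2 - 1\<close>.\<close>
  then have "e \<noteq> 0" using assms(2) by (intro notI) simp
  then have "p dvd CARD('a)" by (simp add: assms(2))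
  then have pq: "\<not> p dvd CARD('a) ^ 2 - 1"
    using q2 assms(1) dvd_diffD1[of p "CARD('a) ^ 2" 1]
    by (auto simp: power2_eq_square not_prime_1)
  have "multiplicity p (order (SL2 :: ('a^2^2) monoid)) = e"
  proof (rule multiplicity_eqI)
    show "p ^ e dvd order (SL2 :: ('a^2^2) monoid)" by (simp add: order_SL2 assms(2))
    show "\<not> p ^ Suc e dvd order (SL2 :: ('a^2^2) monoid)"
      using pq assms by (auto simp: order_SL2 mult.commute)
  qed
  then have syl: "sylow_subgroups p (SL2 :: ('a^2^2) monoid) = {T. subgroup T SL2 \<and> card T = CARD('a)}"
    by (simp add: sylow_subgroups_def assms(2))
  have "T \<in> root_subgroups" if T: "subgroup T SL2" "card T = CARD('a)" for T :: "('a^2^2) set"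
  proof -
    let ?E = "{v. v \<noteq> 0} :: ('a^2) set" and ?phi = "\<lambda>A. \<lambda>v\<in>{v. v \<noteq> 0}. A *v (v :: 'a^2)"
    interpret group_action "SL2\<lparr>carrier := T\<rparr>" ?E ?phi
      by (rule group_action.induced_action[OF SL2_action_nonzero_vectors T(1)])
    have "\<exists>v\<in>?E. \<forall>A\<in>carrier (SL2\<lparr>carrier := T\<rparr>). ?phi A v = v"
      by (rule p_group_fixed_point[OF assms(1)])
        (use T pq in \<open>simp_all add: order_def assms(2) card_nonzero_vectors\<close>)
    then obtain v where v: "v \<noteq> 0" "\<And>A. A \<in> T \<Longrightarrow> A *v v = v" by auto
    obtain a b where ab: "v = vector [a, b]" using forall_vector_2[of "\<lambda>v. \<exists>a b. v = vector [a, b]"] by blast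
    have nz: "(a, b) \<noteq> (0, 0)" using v(1) by (auto simp: ab vec_eq_iff forall_2)
    have "T \<subseteq> root_subgroup a b"
      using v(2) subgroup.subset[OF T(1)] SL2_vec_fixers[OF nz] by (auto simp: ab)
    then have "T = root_subgroup a b"
      using card_root_subgroup[OF nz] T(2) by (intro card_subset_eq) auto
    then show ?thesis using nz by (auto simp: root_subgroups_def)
  qed
  then show ?thesis
    unfolding syl by (auto simp: root_subgroups_def subgroup_root_subgroup card_root_subgroup)
qed

section \<open>Recovering the two coset partitions\<close>

text \<open>Cliques of the relation ``agree in some coordinate'' are contained in coordinate lines, so
  the relation determines the two families of coordinate lines up to interchange.\<close>

lemma agree_in_some_coordinate_determines_coordinates:
  fixes r l r' l' :: "'x \<Rightarrow> 'c"
  assumes two: "a0 \<in> A" "b0 \<in> A" "a0 \<noteq> b0"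
    and surj: "\<And>a b. a \<in> A \<Longrightarrow> b \<in> A \<Longrightarrow> \<exists>x\<in>X. r x = a \<and> l x = b"
    and surj': "\<And>a b. a \<in> A \<Longrightarrow> b \<in> A \<Longrightarrow> \<exists>x\<in>X. r' x = a \<and> l' x = b"
    and ran: "\<And>x. x \<in> X \<Longrightarrow> r x \<in> A \<and> l x \<in> A \<and> r' x \<in> A \<and> l' x \<in> A"
    and agree: "\<And>x y. x \<in> X \<Longrightarrow> y \<in> X \<Longrightarrow>
      r x = r y \<or> l x = l y \<longleftrightarrow> r' x = r' y \<or> l' x = l' y"
  shows "(\<forall>x\<in>X. \<forall>y\<in>X. (r x = r y \<longrightarrow> r' x = r' y) \<and> (l x = l y \<longrightarrow> l' x = l' y)) \<or>
    (\<forall>x\<in>X. \<forall>y\<in>X. (r x = r y \<longrightarrow> l' x = l' y) \<and> (l x = l y \<longrightarrow> r' x = r' y))"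
proof -
  \<comment> \<open>Two equivalence relations on K whose union is total cannot both be proper, much
    as a group is not the union of two proper subgroups.\<close>
  have clique: "(\<forall>x\<in>K. \<forall>y\<in>K. f x = f y) \<or> (\<forall>x\<in>K. \<forall>y\<in>K. g x = g y)"
    if "\<And>x y. x \<in> K \<Longrightarrow> y \<in> K \<Longrightarrow> f x = f y \<or> g x = g y" for K and f g :: "'x \<Rightarrow> 'c"
    using that by metis
  define row where "row f a = {x\<in>X. f x = a}" for f :: "'x \<Rightarrow> 'c" and a
  have row_image: "(\<exists>c\<in>A. row f a = row r' c) \<or> (\<exists>c\<in>A. row f a = row l' c)"
    if fg: "(f, g) = (r, l) \<or> (f, g) = (l, r)" and a: "a \<in> A" for f g a
  proof -
    have fg_agree: "f x = f y \<or> g x = g y \<longleftrightarrow> r' x = r' y \<or> l' x = l' y"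
      if "x \<in> X" "y \<in> X" for x y using fg agree[OF that] by auto
    have ex: "\<exists>x\<in>row f a. g x = b" if "b \<in> A" for b
      using fg
    proof
      assume "(f, g) = (r, l)"
      then show ?thesis using surj[OF a that] by (auto simp: row_def)
    next
      assume "(f, g) = (l, r)"
      then show ?thesis using surj[OF that a] by (auto simp: row_def)
    qed
    \<comment> \<open>Two points of the line that differ in the other coordinate g. A clique
      containing both is not g-constant, so it must be f-constant; here the two distinct values a0
      and b0 enter.\<close>
    obtain x0 x1 where x01: "x0 \<in> row f a" "g x0 = a0" "x1 \<in> row f a" "g x1 = b0"
      using ex[OF two(1)] ex[OF two(2)] by blast
    have into: "row f a = row h (h x0)"
      if h: "(h, k) = (r', l') \<or> (h, k) = (l', r')"
        and const: "\<forall>x\<in>row f a. \<forall>y\<in>row f a. h x = h y" for h k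
    proof
      show sub: "row f a \<subseteq> row h (h x0)" using const x01(1) unfolding row_def by blast
      have "(\<forall>x\<in>row h (h x0). \<forall>y\<in>row h (h x0). f x = f y)
          \<or> (\<forall>x\<in>row h (h x0). \<forall>y\<in>row h (h x0). g x = g y)"
      proof (rule clique)
        fix x y assume "x \<in> row h (h x0)" "y \<in> row h (h x0)"
        then have "x \<in> X" "y \<in> X" "h x = h y" by (auto simp: row_def)
        then show "f x = f y \<or> g x = g y" using fg_agree[of x y] h by auto
      qed
      moreover have "x0 \<in> row h (h x0)" "x1 \<in> row h (h x0)" using sub x01 by auto
      moreover have "g x0 \<noteq> g x1" using x01 two by simp
      ultimately have "\<forall>x\<in>row h (h x0). f x = f x0" by blast
      then show "row h (h x0) \<subseteq> row f a" using x01(1) unfolding row_def by blast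
    qed
    have "(\<forall>x\<in>row f a. \<forall>y\<in>row f a. r' x = r' y) \<or> (\<forall>x\<in>row f a. \<forall>y\<in>row f a. l' x = l' y)"
      by (rule clique) (use fg_agree in \<open>force simp: row_def\<close>)
    moreover have "r' x0 \<in> A" "l' x0 \<in> A" using x01 ran by (simp_all add: row_def)
    ultimately show ?thesis using into[of r' l'] into[of l' r'] by blast
  qed
  \<comment> \<open>Lines of different families meet, distinct lines of the same family do not. This
    forces all lines of one family to go to the same family.\<close>
  have cross: "row r' c \<inter> row l' d \<noteq> {}" if "c \<in> A" "d \<in> A" for c d
    using surj'[OF that] by (auto simp: row_def)
  have crossr: "row r c \<inter> row l d \<noteq> {}" if "c \<in> A" "d \<in> A" for c d
    using surj[OF that] by (auto simp: row_def)
  have disj: "row f c \<inter> row f d = {}" if "c \<noteq> d" for f c d using that by (auto simp: row_def)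
  have use: "h x = h y" if "x \<in> X" "y \<in> X" "f x = f y" "row f (f x) = row h c"
    for f h :: "'x \<Rightarrow> 'c" and x y c
  proof -
    have "x \<in> row f (f x)" "y \<in> row f (f x)" using that(1-3) by (simp_all add: row_def)
    then show ?thesis unfolding that(4) by (simp add: row_def)
  qed
  have all: "(\<forall>a\<in>A. \<exists>c\<in>A. row f a = row r' c) \<or> (\<forall>a\<in>A. \<exists>c\<in>A. row f a = row l' c)"
    if fg: "(f, g) = (r, l) \<or> (f, g) = (l, r)" for f g
  proof (rule ccontr)
    assume "\<not> ?thesis"
    then obtain a b where ab: "a \<in> A" "b \<in> A"
      "\<not> (\<exists>c\<in>A. row f a = row r' c)" "\<not> (\<exists>c\<in>A. row f b = row l' c)" by blast
    then obtain c d where "c \<in> A" "d \<in> A" "row f a = row l' c" "row f b = row r' d"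
      using row_image[OF fg ab(1)] row_image[OF fg ab(2)] by blast
    then show False using cross[of d c] disj[of a b f] ab by (cases "a = b") auto
  qed
  \<comment> \<open>If both families went to the same one, the meeting lines \<open>r = a0\<close>
    and \<open>l = a0\<close> would coincide, but a point with \<open>r = a0\<close> and
    \<open>l = b0\<close> lies only on the first.\<close>
  have not_both: False
    if h: "\<forall>a\<in>A. \<exists>c\<in>A. row r a = row h c" "\<forall>a\<in>A. \<exists>c\<in>A. row l a = row h c" for h
  proof -
    obtain c d where cd: "row r a0 = row h c" "row l a0 = row h d" using h two(1) by blast
    have "row r a0 = row l a0"
      using crossr[OF two(1) two(1)] cd disj[of c d h] by (cases "c = d") auto
    moreover obtain x where "x \<in> X" "r x = a0" "l x = b0" using surj[OF two(1,2)] by blast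
    ultimately have "x \<in> row l a0" by (auto simp: row_def)
    then show False using \<open>l x = b0\<close> two(3) by (simp add: row_def)
  qed
  consider "\<forall>a\<in>A. \<exists>c\<in>A. row r a = row r' c" "\<forall>a\<in>A. \<exists>c\<in>A. row l a = row l' c"
    | "\<forall>a\<in>A. \<exists>c\<in>A. row r a = row l' c" "\<forall>a\<in>A. \<exists>c\<in>A. row l a = row r' c"
    using all[of r l] all[of l r] not_both[of r'] not_both[of l'] by blast
  then show ?thesis
  proof cases
    case 1 then show ?thesis using use[of _ _ r r'] use[of _ _ l l'] ran by blast
  next
    case 2 then show ?thesis using use[of _ _ r l'] use[of _ _ l r'] ran by blast
  qed
qed

section \<open>A joining criterion invariant under isomorphisms\<close>

definition collinear_in :: "'p set set \<Rightarrow> 'p \<Rightarrow> 'p \<Rightarrow> bool"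
  where "collinear_in \<B> x y \<longleftrightarrow> (\<exists>B\<in>\<B>. x \<in> B \<and> y \<in> B)"

text \<open>For root subgroup cosets, the points of M joined to a point of L are given by an affine
  equation, uniquely solvable iff its slope is nonzero. That slope is itself affine in the parameter
  of the point on L, and the definition says that it vanishes everywhere or nowhere, so that it is
  constant.\<close>

definition uniformly_joined :: "'p set set \<Rightarrow> 'p set \<Rightarrow> 'p set \<Rightarrow> bool"
  where "uniformly_joined \<B> L M \<longleftrightarrow>
    (\<forall>x\<in>L. \<exists>!y. y \<in> M \<and> collinear_in \<B> x y) \<or> (\<forall>x\<in>L. \<not> (\<exists>!y. y \<in> M \<and> collinear_in \<B> x y))"

lemma ex1_in_image_iff:
  assumes "inj_on f A"
  shows "(\<exists>!z. z \<in> f ` A \<and> Q z) \<longleftrightarrow> (\<exists>!s. s \<in> A \<and> Q (f s))"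
proof
  assume "\<exists>!z. z \<in> f ` A \<and> Q z"
  then show "\<exists>!s. s \<in> A \<and> Q (f s)" using inj_onD[OF assms] by blast
next
  assume "\<exists>!s. s \<in> A \<and> Q (f s)"
  then show "\<exists>!z. z \<in> f ` A \<and> Q z" by blast
qed

lemma uniformly_joined_image:
  assumes inj: "inj_on \<psi> E" and sub: "\<Union>\<B> \<subseteq> E" and im: "(`) \<psi> ` \<B> = \<B>'"
    and LM: "L \<in> \<B>" "M \<in> \<B>"
  shows "uniformly_joined \<B>' (\<psi> ` L) (\<psi> ` M) \<longleftrightarrow> uniformly_joined \<B> L M"
proof -
  have coll: "collinear_in \<B>' (\<psi> x) (\<psi> y) \<longleftrightarrow> collinear_in \<B> x y" if "x \<in> E" "y \<in> E" for x y
  proof -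
    have "\<psi> z \<in> \<psi> ` B \<longleftrightarrow> z \<in> B" if "z \<in> E" "B \<in> \<B>" for z B
      using inj_on_image_mem_iff[OF inj that(1)] sub that(2) by blast
    then show ?thesis using that by (auto simp: collinear_in_def im[symmetric])
  qed
  have "(\<exists>!y'. y' \<in> \<psi> ` M \<and> collinear_in \<B>' (\<psi> x) y') \<longleftrightarrow> (\<exists>!y. y \<in> M \<and> collinear_in \<B> x y)"
    if x: "x \<in> L" for x
  proof -
    have xE: "x \<in> E" and ME: "M \<subseteq> E" using x LM sub by auto
    have "(\<exists>!y'. y' \<in> \<psi> ` M \<and> collinear_in \<B>' (\<psi> x) y')
        \<longleftrightarrow> (\<exists>!y. y \<in> M \<and> collinear_in \<B>' (\<psi> x) (\<psi> y))"
      by (rule ex1_in_image_iff[OF inj_on_subset[OF inj ME]])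
    also have "(\<lambda>y. y \<in> M \<and> collinear_in \<B>' (\<psi> x) (\<psi> y)) = (\<lambda>y. y \<in> M \<and> collinear_in \<B> x y)"
      using coll[OF xE] ME by blast
    finally show ?thesis .
  qed
  then show ?thesis by (simp add: uniformly_joined_def)
qed

section \<open>Cosets as blocks and their two quotient subgroups\<close>

definition left_coset_blocks :: "('g, 'm) monoid_scheme \<Rightarrow> 'g set set \<Rightarrow> 'g set set"
  where "left_coset_blocks G P = {x <#\<^bsub>G\<^esub> T | x T. x \<in> carrier G \<and> T \<in> P}"

definition left_quotients :: "('g, 'm) monoid_scheme \<Rightarrow> 'g set \<Rightarrow> 'g set"
  where "left_quotients G L = {inv\<^bsub>G\<^esub> x \<otimes>\<^bsub>G\<^esub> y | x y. x \<in> L \<and> y \<in> L}"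

definition right_quotients :: "('g, 'm) monoid_scheme \<Rightarrow> 'g set \<Rightarrow> 'g set"
  where "right_quotients G L = {x \<otimes>\<^bsub>G\<^esub> inv\<^bsub>G\<^esub> y | x y. x \<in> L \<and> y \<in> L}"

context group
begin

lemma inv_mult_cancel:
  "x \<in> carrier G \<Longrightarrow> y \<in> carrier G \<Longrightarrow> inv x \<otimes> (x \<otimes> y) = y"
  "x \<in> carrier G \<Longrightarrow> y \<in> carrier G \<Longrightarrow> x \<otimes> (inv x \<otimes> y) = y"
  by (simp_all add: m_assoc[symmetric])

lemma left_quotients_l_coset:
  assumes "subgroup T G" "x \<in> carrier G"
  shows "left_quotients G (x <# T) = T"
proof -
  interpret T: subgroup T G by fact
  have "inv (x \<otimes> t) \<otimes> (x \<otimes> u) = inv t \<otimes> u" if "t \<in> T" "u \<in> T" for t u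
    using assms that by (simp add: inv_mult_group m_assoc inv_mult_cancel)
  then have "left_quotients G (x <# T) = {inv t \<otimes> u | t u. t \<in> T \<and> u \<in> T}"
    unfolding left_quotients_def l_coset_def by (auto; metis)
  also have "\<dots> = T"
  proof (intro equalityI subsetI)
    fix t assume "t \<in> T"
    then have "t = inv \<one> \<otimes> t" by simp
    then show "t \<in> {inv t \<otimes> u | t u. t \<in> T \<and> u \<in> T}" using \<open>t \<in> T\<close> T.one_closed by blast
  qed auto
  finally show ?thesis .
qed

lemma right_quotients_r_coset:
  assumes "subgroup T G" "x \<in> carrier G"
  shows "right_quotients G (T #> x) = T"
proof -
  interpret T: subgroup T G by fact
  have "t \<otimes> x \<otimes> inv (u \<otimes> x) = t \<otimes> inv u" if "t \<in> T" "u \<in> T" for t u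
    using assms that by (simp add: inv_mult_group m_assoc inv_mult_cancel)
  then have "right_quotients G (T #> x) = {t \<otimes> inv u | t u. t \<in> T \<and> u \<in> T}"
    unfolding right_quotients_def r_coset_def by (auto; metis)
  also have "\<dots> = T"
  proof (intro equalityI subsetI)
    fix t assume "t \<in> T"
    then have "t = t \<otimes> inv \<one>" by simp
    then show "t \<in> {t \<otimes> inv u | t u. t \<in> T \<and> u \<in> T}" using \<open>t \<in> T\<close> T.one_closed by blast
  qed auto
  finally show ?thesis .
qed

lemma l_coset_eq_r_coset_conj:
  assumes "T \<subseteq> carrier G" "x \<in> carrier G"
  shows "x <# T = (x <# T #> inv x) #> x"
  using assms by (simp add: coset_mult_assoc l_coset_subset_G coset_mult_one)

lemma r_coset_eq_l_coset_conj:
  assumes "T \<subseteq> carrier G" "x \<in> carrier G"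
  shows "T #> x = x <# (inv x <# T #> x)"
proof -
  have "x <# (inv x <# T #> x) = x <# (inv x <# (T #> x))"
    using assms by (simp add: coset_assoc)
  also have "\<dots> = T #> x"
    using assms by (simp add: lcos_m_assoc r_coset_subset_G lcos_mult_one)
  finally show ?thesis by simp
qed

end

context group
begin

text \<open>Every point of a coset can serve as its representative, so a block is determined by one
  of its points together with either coordinate.\<close>

lemma left_coset_block_through:
  assumes "\<And>T. T \<in> P \<Longrightarrow> subgroup T G"
    and "L \<in> left_coset_blocks G P" "z \<in> L"
  shows "L = z <# left_quotients G L" "L = right_quotients G L #> z" "left_quotients G L \<in> P"
proof -
  obtain x T where L: "L = x <# T" "x \<in> carrier G" "T \<in> P"
    using assms(2) by (auto simp: left_coset_blocks_def)
  interpret T: subgroup T G using assms(1) L(3) .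
  have z: "z \<in> carrier G" using assms(3) L T.subset by (auto simp: l_coset_def)
  have Lz: "L = z <# T"
    using l_repr_independence[OF _ L(2) T.subgroup_axioms, of z] assms(3) L(1) by simp
  show "L = z <# left_quotients G L" "left_quotients G L \<in> P"
    using Lz L(3) by (simp_all add: left_quotients_l_coset[OF T.subgroup_axioms z])
  let ?C = "z <# T #> inv z"
  have "subgroup ?C G"
    using subgroup_conjugation_is_surj1[OF inv_closed[OF z] T.subgroup_axioms] z by simp
  then have "right_quotients G L = ?C"
    using right_quotients_r_coset z l_coset_eq_r_coset_conj[OF T.subset z] Lz by metis
  then show "L = right_quotients G L #> z"
    using l_coset_eq_r_coset_conj[OF T.subset z] Lz by simp
qed

lemma conj_mult:
  assumes "T \<subseteq> carrier G" "x \<in> carrier G" "y \<in> carrier G"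
  shows "(x \<otimes> y) <# T #> inv (x \<otimes> y) = x <# (y <# T #> inv y) #> inv x"
proof -
  have "(x \<otimes> y) <# T #> inv (x \<otimes> y) = (x <# (y <# T)) #> (inv y \<otimes> inv x)"
    using assms by (simp add: lcos_m_assoc inv_mult_group)
  also have "\<dots> = (x <# (y <# T)) #> inv y #> inv x"
    using assms by (simp add: coset_mult_assoc l_coset_subset_G)
  also have "\<dots> = x <# (y <# T #> inv y) #> inv x"
    using assms by (simp add: coset_assoc l_coset_subset_G)
  finally show ?thesis .
qed

lemma conj_one: "T \<subseteq> carrier G \<Longrightarrow> \<one> <# T #> inv \<one> = T"
  by (simp add: lcos_mult_one coset_mult_one)

lemma conj_eq_if_cosets_eq:
  assumes "x \<in> carrier G" "T \<subseteq> carrier G" "U \<subseteq> carrier G" "x <# T = U #> x"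
  shows "x <# T #> inv x = U"
  using assms by (simp add: coset_mult_assoc coset_mult_one)

text \<open>Writing \<open>xT\<close> as a right coset of the conjugate \<open>xTx\<^sup>-\<^sup>1\<close> shows that \<open>\<psi>\<close> intertwines the
  conjugation actions of \<open>x\<close> and \<open>\<psi> x\<close> on \<open>P\<close>, so that \<open>\<psi>\<close> is multiplicative up to elements
  normalizing every member of \<open>P\<close>. If the second factor lies in some \<open>T \<in> P\<close>, the error term lies
  in \<open>\<psi> T\<close> as well and vanishes.\<close>

lemma hom_if_preserves_cosets:
  assumes sub: "\<And>T. T \<in> P \<Longrightarrow> subgroup T G"
    and conj: "\<And>x T. x \<in> carrier G \<Longrightarrow> T \<in> P \<Longrightarrow> x <# T #> inv x \<in> P"
    and triv: "\<And>T z. T \<in> P \<Longrightarrow> z \<in> T \<Longrightarrow> (\<And>U. U \<in> P \<Longrightarrow> z <# U #> inv z = U) \<Longrightarrow> z = \<one>"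
    and gen: "generate G (\<Union>P) = carrier G"
    and clos: "\<And>x. x \<in> carrier G \<Longrightarrow> \<psi> x \<in> carrier G"
    and P: "(`) \<psi> ` P = P"
    and left: "\<And>T x. T \<in> P \<Longrightarrow> x \<in> carrier G \<Longrightarrow> \<psi> ` (x <# T) = \<psi> x <# \<psi> ` T"
    and right: "\<And>T x. T \<in> P \<Longrightarrow> x \<in> carrier G \<Longrightarrow> \<psi> ` (T #> x) = \<psi> ` T #> \<psi> x"
  shows "\<psi> \<in> hom G G"
proof -
  have subset: "T \<subseteq> carrier G" if "T \<in> P" for T using sub[OF that] by (rule subgroup.subset)
  have psiP: "\<psi> ` T \<in> P" if "T \<in> P" for T using P that by blast
  have equivariant: "\<psi> ` (x <# T #> inv x) = \<psi> x <# \<psi> ` T #> inv (\<psi> x)"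
    if x: "x \<in> carrier G" and T: "T \<in> P" for x T
  proof -
    have "\<psi> x <# \<psi> ` T = \<psi> ` (x <# T)" using left x T by simp
    also have "\<dots> = \<psi> ` ((x <# T #> inv x) #> x)"
      using l_coset_eq_r_coset_conj[OF subset[OF T] x] by simp
    also have "\<dots> = \<psi> ` (x <# T #> inv x) #> \<psi> x" using right conj x T by simp
    finally show ?thesis
      using conj_eq_if_cosets_eq clos x T psiP conj subset by metis
  qed
  have mult: "\<psi> (x \<otimes> u) = \<psi> x \<otimes> \<psi> u" if x: "x \<in> carrier G" and T: "T \<in> P" and u: "u \<in> T" for x T u
  proof -
    have u': "u \<in> carrier G" using u T subset by blast
    note cl = clos[OF x] clos[OF u'] clos[OF m_closed[OF x u']]
    interpret psiT: subgroup "\<psi> ` T" G using sub psiP T by blast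
    have "\<psi> (x \<otimes> u) \<in> \<psi> x <# \<psi> ` T"
      using left[OF T x, symmetric] u by (auto simp: l_coset_def)
    then obtain w where w: "w \<in> \<psi> ` T" "\<psi> (x \<otimes> u) = \<psi> x \<otimes> w" by (auto simp: l_coset_def)
    \<comment> \<open>The error term of multiplicativity: \<open>\<psi> (x u)\<close> equals
      \<open>\<psi> x \<otimes> \<psi> u \<otimes> z\<close>.\<close>
    define z where "z = inv (\<psi> u) \<otimes> w"
    have zT: "z \<in> \<psi> ` T" using u w(1) by (simp add: z_def)
    have wc: "w \<in> carrier G" and zc: "z \<in> carrier G" using w(1) zT psiT.subset by blast+
    have wz: "w = \<psi> u \<otimes> z" using wc cl by (simp add: z_def inv_mult_cancel)
    \<comment> \<open>Conjugation by \<open>\<psi> (x u)\<close> is evaluated twice: as conjugation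
      by \<open>?g z\<close>, and through \<open>equivariant\<close> as conjugation by
      \<open>\<psi> u\<close> followed by \<open>\<psi> x\<close>. Undoing \<open>?g\<close> leaves
      z.\<close>
    have "z <# U #> inv z = U" if U: "U \<in> P" for U
    proof -
      obtain V where V: "V \<in> P" "U = \<psi> ` V" using P U by blast
      have Us: "U \<subseteq> carrier G" and Vs: "V \<subseteq> carrier G" using U V subset by auto
      let ?g = "\<psi> x \<otimes> \<psi> u"
      have g: "?g \<in> carrier G" using cl by simp
      have "?g <# (z <# U #> inv z) #> inv ?g = (?g \<otimes> z) <# U #> inv (?g \<otimes> z)"
        using conj_mult[OF Us g zc] by simp
      also have "?g \<otimes> z = \<psi> (x \<otimes> u)" using w(2) wz cl zc by (simp add: m_assoc)
      also have "\<psi> (x \<otimes> u) <# U #> inv (\<psi> (x \<otimes> u)) = \<psi> ` ((x \<otimes> u) <# V #> inv (x \<otimes> u))"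
        using equivariant[OF m_closed[OF x u'] V(1)] V(2) by simp
      also have "\<dots> = \<psi> ` (x <# (u <# V #> inv u) #> inv x)"
        using conj_mult[OF Vs x u'] by simp
      also have "\<dots> = \<psi> x <# (\<psi> u <# U #> inv (\<psi> u)) #> inv (\<psi> x)"
        using equivariant[OF x conj[OF u' V(1)]] equivariant[OF u' V(1)] V(2) by simp
      also have "\<dots> = ?g <# U #> inv ?g" using conj_mult[OF Us cl(1,2)] by simp
      finally have eq: "?g <# (z <# U #> inv z) #> inv ?g = ?g <# U #> inv ?g" .
      have undo: "inv ?g <# (?g <# W #> inv ?g) #> inv (inv ?g) = W" if "W \<subseteq> carrier G" for W
        using conj_mult[OF that inv_closed[OF g] g] conj_one[OF that] g by simp
      show ?thesis
        using undo[of U] undo[of "z <# U #> inv z"] eq Us conj[OF zc U] subset by metis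
    qed
    then have "z = \<one>" using triv[OF psiP[OF T] zT] by blast
    then show ?thesis using w(2) wz cl by simp
  qed
  \<comment> \<open>The left factor x stays quantified because the product case applies the
    hypothesis for k at \<open>x \<otimes> h\<close>.\<close>
  have "\<forall>x\<in>carrier G. \<psi> (x \<otimes> y) = \<psi> x \<otimes> \<psi> y" if "y \<in> generate G (\<Union>P)" for y
    using that
  proof (induction rule: generate.induct)
    case one
    \<comment> \<open>The identity lies in any member of P; if P is empty, generation by P makes the
      group trivial.\<close>
    show ?case
    proof (cases "P = {}")
      case True
      then have "carrier G = {\<one>}" using gen generate_empty by simp
      then have "\<psi> \<one> = \<one>" using clos by auto
      then show ?thesis using clos by simp
    next
      case False
      then obtain T where "T \<in> P" by blast
      then show ?thesis using mult[OF _ _ subgroup.one_closed[OF sub]] by simp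
    qed
  next
    case (incl h)
    then show ?case using mult by (metis UnionE)
  next
    case (inv h)
    then obtain T where T: "T \<in> P" "h \<in> T" by blast
    then have "inv h \<in> T" using subgroup.m_inv_closed[OF sub[OF T(1)]] by blast
    then show ?case using mult T(1) by blast
  next
    case (eng h k)
    have hk: "h \<in> carrier G" "k \<in> carrier G" using eng gen by auto
    show ?case
    proof
      fix x assume x: "x \<in> carrier G"
      have "\<psi> (x \<otimes> (h \<otimes> k)) = \<psi> ((x \<otimes> h) \<otimes> k)" using x hk by (simp add: m_assoc)
      also have "\<dots> = \<psi> (x \<otimes> h) \<otimes> \<psi> k" using eng.IH(2) m_closed[OF x hk(1)] by blast
      also have "\<psi> (x \<otimes> h) = \<psi> x \<otimes> \<psi> h" using eng.IH(1) x by blast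
      also have "\<psi> x \<otimes> \<psi> h \<otimes> \<psi> k = \<psi> x \<otimes> (\<psi> h \<otimes> \<psi> k)"
        using clos[OF x] clos[OF hk(1)] clos[OF hk(2)] by (rule m_assoc)
      also have "\<psi> h \<otimes> \<psi> k = \<psi> (h \<otimes> k)" using eng.IH(2) hk(1) by simp
      finally show "\<psi> (x \<otimes> (h \<otimes> k)) = \<psi> x \<otimes> \<psi> (h \<otimes> k)" .
    qed
  qed
  then show ?thesis using gen clos by (intro homI) auto
qed

text \<open>A short block has its right and left quotients as coordinates. By \<open>trans\<close>
  all pairs occur, and by \<open>joined\<close> sharing a coordinate is an incidence property, which
  \<psi> respects; the lemma on coordinate lines gives the dichotomy. As \<psi> fixes the identity,
  it permutes P, the set of blocks through it, and this anchors the images of the cosets.\<close>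

lemma coset_blocks_preserved_or_swapped:
  assumes sub: "\<And>T. T \<in> P \<Longrightarrow> subgroup T G"
    and conj: "\<And>x T. x \<in> carrier G \<Longrightarrow> T \<in> P \<Longrightarrow> x <# T #> inv x \<in> P"
    and trans: "\<And>T U. T \<in> P \<Longrightarrow> U \<in> P \<Longrightarrow> \<exists>x\<in>carrier G. x <# T #> inv x = U"
    and two: "T\<^sub>0 \<in> P" "U\<^sub>0 \<in> P" "T\<^sub>0 \<noteq> U\<^sub>0"
    and joined: "\<And>x y T U. x \<in> carrier G \<Longrightarrow> y \<in> carrier G \<Longrightarrow> T \<in> P \<Longrightarrow> U \<in> P \<Longrightarrow>
      uniformly_joined (left_coset_blocks G P) (x <# T) (y <# U)
        \<longleftrightarrow> T = U \<or> x <# T #> inv x = y <# U #> inv y"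
    and bij: "bij_betw \<psi> (carrier G) (carrier G)" and one: "\<psi> \<one> = \<one>"
    and blocks: "(`) \<psi> ` left_coset_blocks G P = left_coset_blocks G P"
  shows "(`) \<psi> ` P = P"
    and "(\<forall>T\<in>P. \<forall>x\<in>carrier G. \<psi> ` (x <# T) = \<psi> x <# \<psi> ` T \<and> \<psi> ` (T #> x) = \<psi> ` T #> \<psi> x) \<or>
      (\<forall>T\<in>P. \<forall>x\<in>carrier G. \<psi> ` (x <# T) = \<psi> ` T #> \<psi> x \<and> \<psi> ` (T #> x) = \<psi> x <# \<psi> ` T)"
proof -
  let ?B = "left_coset_blocks G P" and ?l = "left_quotients G" and ?r = "right_quotients G"
  have subset: "T \<subseteq> carrier G" if "T \<in> P" for T using sub[OF that] by (rule subgroup.subset)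
  have l: "?l (x <# T) = T" if "x \<in> carrier G" "T \<in> P" for x T
    using left_quotients_l_coset sub that by blast
  have r: "?r (x <# T) = x <# T #> inv x" if "x \<in> carrier G" "T \<in> P" for x T
    using right_quotients_r_coset[OF sub[OF conj[OF that]] that(1)]
      l_coset_eq_r_coset_conj[OF subset[OF that(2)] that(1)] by simp
  have lr: "?r (T #> x) = T" "T #> x \<in> ?B"
    if "x \<in> carrier G" "T \<in> P" for x T
  proof -
    have c: "inv x <# T #> x \<in> P" using conj[of "inv x" T] that by simp
    show "?r (T #> x) = T" using right_quotients_r_coset sub that by blast
    show "T #> x \<in> ?B"
      using that(1) c r_coset_eq_l_coset_conj[OF subset[OF that(2)] that(1)]
      by (auto simp: left_coset_blocks_def)
  qed
  have mem: "x <# T \<in> ?B" if "x \<in> carrier G" "T \<in> P" for x T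
    using that by (auto simp: left_coset_blocks_def)
  \<comment> \<open>Both coordinates of T, viewed as a block, are T. A coset shares one of them with
    T, so one coordinate of its image is known.\<close>
  have PB: "T \<in> ?B" "?l T = T" "?r T = T" if "T \<in> P" for T
    using mem[OF one_closed that] l[OF one_closed that] r[OF one_closed that]
      lcos_mult_one[OF subset[OF that]] coset_mult_one[OF subset[OF that]] by simp_all
  have through_one: "L \<in> P" if "L \<in> ?B" "\<one> \<in> L" for L
  proof -
    have "L = \<one> <# ?l L" "?l L \<in> P" using left_coset_block_through(1,3)[OF sub that] by simp_all
    then show ?thesis using lcos_mult_one subset by simp
  qed
  have inj: "inj_on \<psi> (carrier G)" using bij by (rule bij_betw_imp_inj_on)
  have BG: "\<Union>?B \<subseteq> carrier G" using subset l_coset_subset_G by (auto simp: left_coset_blocks_def) blast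
  have psiB: "\<psi> ` L \<in> ?B" if "L \<in> ?B" for L using blocks that by blast
  have one_mem: "\<one> \<in> T" if "T \<in> P" for T using sub[OF that] by (rule subgroup.one_closed)
  have psiP: "\<psi> ` T \<in> P" if "T \<in> P" for T
    using through_one[OF psiB[OF PB(1)[OF that]]] one_mem[OF that] one by force
  show "(`) \<psi> ` P = P"
  proof
    show "(`) \<psi> ` P \<subseteq> P" using psiP by blast
    show "P \<subseteq> (`) \<psi> ` P"
    proof
      fix T assume T: "T \<in> P"
      then obtain L where L: "L \<in> ?B" "T = \<psi> ` L" using blocks PB(1) by blast
      then obtain z where "z \<in> L" "\<psi> z = \<one>" using one_mem[OF T] by auto
      then have "z = \<one>" using inj_onD[OF inj, of z \<one>] one BG L(1) by auto
      then show "T \<in> (`) \<psi> ` P" using through_one[OF L(1)] \<open>z \<in> L\<close> L(2) by blast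
    qed
  qed
  have lP: "?l L \<in> P" "?r L \<in> P" if "L \<in> ?B" for L
    using that l r conj by (auto simp: left_coset_blocks_def)
  \<comment> \<open>Choose x conjugating U to T; then \<open>x U\<close> has left quotients U and
    right quotients T.\<close>
  have surj: "\<exists>L\<in>?B. ?r L = T \<and> ?l L = U" if "T \<in> P" "U \<in> P" for T U
    using trans[OF that(2) that(1)] mem l r that(2) by metis
  have dich: "(\<forall>L\<in>?B. \<forall>M\<in>?B. (?r L = ?r M \<longrightarrow> ?r (\<psi> ` L) = ?r (\<psi> ` M)) \<and>
        (?l L = ?l M \<longrightarrow> ?l (\<psi> ` L) = ?l (\<psi> ` M))) \<or>
      (\<forall>L\<in>?B. \<forall>M\<in>?B. (?r L = ?r M \<longrightarrow> ?l (\<psi> ` L) = ?l (\<psi> ` M)) \<and>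
        (?l L = ?l M \<longrightarrow> ?r (\<psi> ` L) = ?r (\<psi> ` M)))"
  proof (rule agree_in_some_coordinate_determines_coordinates[OF two])
    show "\<exists>L\<in>?B. ?r (\<psi> ` L) = T \<and> ?l (\<psi> ` L) = U" if TU: "T \<in> P" "U \<in> P" for T U
      using surj[OF TU] blocks by (metis imageE)
    show "?r L \<in> P \<and> ?l L \<in> P \<and> ?r (\<psi> ` L) \<in> P \<and> ?l (\<psi> ` L) \<in> P" if "L \<in> ?B" for L
      using that lP psiB by blast
    have agree: "?r L = ?r M \<or> ?l L = ?l M \<longleftrightarrow> uniformly_joined ?B L M"
      if LM: "L \<in> ?B" "M \<in> ?B" for L M
    proof -
      obtain x T y U where
        "L = x <# T" "x \<in> carrier G" "T \<in> P" "M = y <# U" "y \<in> carrier G" "U \<in> P"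
        using LM unfolding left_coset_blocks_def by blast
      then show ?thesis using joined[of x y T U] by (auto simp only: l r)
    qed
    show "?r L = ?r M \<or> ?l L = ?l M \<longleftrightarrow> ?r (\<psi> ` L) = ?r (\<psi> ` M) \<or> ?l (\<psi> ` L) = ?l (\<psi> ` M)"
      if "L \<in> ?B" "M \<in> ?B" for L M
      using agree[OF that] agree[OF psiB[OF that(1)] psiB[OF that(2)]]
        uniformly_joined_image[OF inj BG blocks that] by blast
  qed (use surj in blast)
  have via_l: "L = \<psi> x <# T" if "L \<in> ?B" "\<psi> x \<in> L" "?l L = T" for L x T
    using left_coset_block_through(1)[OF sub that(1,2)] that(3) by simp
  have via_r: "L = T #> \<psi> x" if "L \<in> ?B" "\<psi> x \<in> L" "?r L = T" for L x T
    using left_coset_block_through(2)[OF sub that(1,2)] that(3) by simp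
  have in_l: "\<psi> x \<in> \<psi> ` (x <# T)" and in_r: "\<psi> x \<in> \<psi> ` (T #> x)"
    if "T \<in> P" "x \<in> carrier G" for T x
    using one_mem[OF that(1)] that(2) by (force simp: l_coset_def r_coset_def)+
  from dich show
    "(\<forall>T\<in>P. \<forall>x\<in>carrier G. \<psi> ` (x <# T) = \<psi> x <# \<psi> ` T \<and> \<psi> ` (T #> x) = \<psi> ` T #> \<psi> x) \<or>
      (\<forall>T\<in>P. \<forall>x\<in>carrier G. \<psi> ` (x <# T) = \<psi> ` T #> \<psi> x \<and> \<psi> ` (T #> x) = \<psi> x <# \<psi> ` T)"
  proof (elim disjE)
    assume *: "\<forall>L\<in>?B. \<forall>M\<in>?B. (?r L = ?r M \<longrightarrow> ?r (\<psi> ` L) = ?r (\<psi> ` M)) \<and>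
        (?l L = ?l M \<longrightarrow> ?l (\<psi> ` L) = ?l (\<psi> ` M))"
    have "\<psi> ` (x <# T) = \<psi> x <# \<psi> ` T" "\<psi> ` (T #> x) = \<psi> ` T #> \<psi> x"
      if T: "T \<in> P" and x: "x \<in> carrier G" for T x
    proof -
      have "?l (\<psi> ` (x <# T)) = ?l (\<psi> ` T)" "?r (\<psi> ` (T #> x)) = ?r (\<psi> ` T)"
        using bspec[OF bspec[OF * mem[OF x T]] PB(1)[OF T]]
          bspec[OF bspec[OF * lr(2)[OF x T]] PB(1)[OF T]]
        by (simp_all add: PB(2,3)[OF T] l[OF x T] lr(1)[OF x T])
      then show "\<psi> ` (x <# T) = \<psi> x <# \<psi> ` T" "\<psi> ` (T #> x) = \<psi> ` T #> \<psi> x"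
        using via_l[OF psiB[OF mem[OF x T]] in_l[OF T x]] via_r[OF psiB[OF lr(2)[OF x T]] in_r[OF T x]]
          PB(2,3)[OF psiP[OF T]] by simp_all
    qed
    then show ?thesis by (intro disjI1 ballI conjI)
  next
    assume *: "\<forall>L\<in>?B. \<forall>M\<in>?B. (?r L = ?r M \<longrightarrow> ?l (\<psi> ` L) = ?l (\<psi> ` M)) \<and>
        (?l L = ?l M \<longrightarrow> ?r (\<psi> ` L) = ?r (\<psi> ` M))"
    have "\<psi> ` (x <# T) = \<psi> ` T #> \<psi> x" "\<psi> ` (T #> x) = \<psi> x <# \<psi> ` T"
      if T: "T \<in> P" and x: "x \<in> carrier G" for T x
    proof -
      have "?r (\<psi> ` (x <# T)) = ?r (\<psi> ` T)" "?l (\<psi> ` (T #> x)) = ?l (\<psi> ` T)"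
        using bspec[OF bspec[OF * mem[OF x T]] PB(1)[OF T]]
          bspec[OF bspec[OF * lr(2)[OF x T]] PB(1)[OF T]]
        by (simp_all add: PB(2,3)[OF T] l[OF x T] lr(1)[OF x T])
      then show "\<psi> ` (x <# T) = \<psi> ` T #> \<psi> x" "\<psi> ` (T #> x) = \<psi> x <# \<psi> ` T"
        using via_r[OF psiB[OF mem[OF x T]] in_l[OF T x]] via_l[OF psiB[OF lr(2)[OF x T]] in_r[OF T x]]
          PB(2,3)[OF psiP[OF T]] by simp_all
    qed
    then show ?thesis by (intro disjI2 ballI conjI)
  qed
qed

end

section \<open>Coset geometry of the root subgroups\<close>

lemma affine_ex1_iff:
  fixes c d :: "'a::field"
  shows "(\<exists>!s. c + s * d = k) \<longleftrightarrow> d \<noteq> 0"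
proof
  assume ex1: "\<exists>!s. c + s * d = k"
  show "d \<noteq> 0"
  proof
    assume "d = 0"
    then have "(\<lambda>s. c + s * d = k) 0 \<longleftrightarrow> (\<lambda>s. c + s * d = k) 1" by simp
    then show False using ex1 \<open>d = 0\<close> by (metis mult_zero_right zero_neq_one)
  qed
next
  assume "d \<noteq> 0"
  then show "\<exists>!s. c + s * d = k"
    by (intro ex1I[of _ "(k - c) / d"]) (auto simp: field_simps)
qed

text \<open>A nonconstant affine function over a field attains both 0 and 1.\<close>

lemma affine_zero_everywhere_or_nowhere_iff:
  fixes c d :: "'a::field"
  shows "(\<forall>t. c + t * d \<noteq> 0) \<or> (\<forall>t. c + t * d = 0) \<longleftrightarrow> d = 0"
proof
  assume *: "(\<forall>t. c + t * d \<noteq> 0) \<or> (\<forall>t. c + t * d = 0)"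
  show "d = 0"
  proof (rule ccontr)
    assume d: "d \<noteq> 0"
    have "c + (- c / d) * d = 0" "c + ((1 - c) / d) * d = 1" using d by simp_all
    then show False using * by (metis zero_neq_one)
  qed
qed simp

lemma collinear_in_root_cosets_iff:
  fixes x y :: "'a::field^2^2"
  assumes "x \<in> carrier SL2" "y \<in> carrier SL2"
  shows "collinear_in (left_coset_blocks SL2 root_subgroups) x y
    \<longleftrightarrow> inv\<^bsub>SL2\<^esub> x \<otimes>\<^bsub>SL2\<^esub> y \<in> \<Union>root_subgroups"
proof -
  interpret SL2: group "SL2 :: ('a^2^2) monoid" by (rule group_SL2)
  show ?thesis
  proof
    assume "collinear_in (left_coset_blocks SL2 root_subgroups) x y"
    then obtain g T where T: "T \<in> root_subgroups" "g \<in> carrier SL2"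
      "x \<in> g <#\<^bsub>SL2\<^esub> T" "y \<in> g <#\<^bsub>SL2\<^esub> T"
      by (auto simp: collinear_in_def left_coset_blocks_def)
    then have "inv\<^bsub>SL2\<^esub> x \<otimes>\<^bsub>SL2\<^esub> y \<in> left_quotients SL2 (g <#\<^bsub>SL2\<^esub> T)"
      by (auto simp: left_quotients_def)
    then show "inv\<^bsub>SL2\<^esub> x \<otimes>\<^bsub>SL2\<^esub> y \<in> \<Union>root_subgroups"
      using SL2.left_quotients_l_coset[OF subgroup_root_subgroups T(2)] T(1) by auto
  next
    assume "inv\<^bsub>SL2\<^esub> x \<otimes>\<^bsub>SL2\<^esub> y \<in> \<Union>root_subgroups"
    then obtain T where T: "T \<in> root_subgroups" "inv\<^bsub>SL2\<^esub> x \<otimes>\<^bsub>SL2\<^esub> y \<in> T" by blast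
    have "x \<otimes>\<^bsub>SL2\<^esub> \<one>\<^bsub>SL2\<^esub> = x" "x \<otimes>\<^bsub>SL2\<^esub> (inv\<^bsub>SL2\<^esub> x \<otimes>\<^bsub>SL2\<^esub> y) = y"
      using assms by (simp_all add: SL2.inv_mult_cancel)
    then have "x \<in> x <#\<^bsub>SL2\<^esub> T" "y \<in> x <#\<^bsub>SL2\<^esub> T"
      using T subgroup.one_closed[OF subgroup_root_subgroups[OF T(1)]] unfolding l_coset_def by force+
    moreover have "x <#\<^bsub>SL2\<^esub> T \<in> left_coset_blocks SL2 root_subgroups"
      using T(1) assms(1) by (auto simp: left_coset_blocks_def)
    ultimately show "collinear_in (left_coset_blocks SL2 root_subgroups) x y"
      unfolding collinear_in_def by blast
  qed
qed

text \<open>Two points are collinear iff their quotient has trace 2. Along the cosets this trace is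
  a bilinear polynomial in the two parameters, and the criterion detects whether its mixed
  coefficient vanishes.\<close>

lemma uniformly_joined_root_cosets_iff:
  fixes x y :: "'a::field^2^2"
  assumes x: "x \<in> carrier SL2" and y: "y \<in> carrier SL2"
    and T: "T \<in> root_subgroups" and U: "U \<in> root_subgroups"
  shows "uniformly_joined (left_coset_blocks SL2 root_subgroups) (x <#\<^bsub>SL2\<^esub> T) (y <#\<^bsub>SL2\<^esub> U)
    \<longleftrightarrow> T = U \<or> x <#\<^bsub>SL2\<^esub> T #>\<^bsub>SL2\<^esub> inv\<^bsub>SL2\<^esub> x = y <#\<^bsub>SL2\<^esub> U #>\<^bsub>SL2\<^esub> inv\<^bsub>SL2\<^esub> y"
proof -
  interpret SL2: group "SL2 :: ('a^2^2) monoid" by (rule group_SL2)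
  obtain a b c d where ab: "T = root_subgroup a b" "(a, b) \<noteq> (0, 0)"
    and cd: "U = root_subgroup c d" "(c, d) \<noteq> (0, 0)"
    using T U by (auto simp: root_subgroups_def)
  define g where "g = inv\<^bsub>SL2\<^esub> x \<otimes>\<^bsub>SL2\<^esub> y"
  have gc: "g \<in> carrier SL2" using x y by (simp add: g_def)
  then obtain k l m n where g: "g = mat2 k l m n" and det1: "k * n - l * m = 1"
    by (rule SL2_cases)
  \<comment> \<open>The trace of the quotient of two points with parameters t and s is
    \<open>\<kappa> t + s (\<beta> + t \<delta>)\<close>. The mixed coefficient \<delta> is, up to
    sign, the product of two determinants: of (a, b) with g (c, d), and of (c, d) with (a, b). Its
    zeros therefore mean \<open>T = g U g^-1\<close> or \<open>T = U\<close>.\<close>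
  define \<beta> where "\<beta> = n * c * d - k * c * d + m * c * c - l * d * d"
  define \<kappa> where "\<kappa> t = (k + n) + t * (k * a * b - m * a * a + l * b * b - n * a * b)" for t
  define \<delta> where "\<delta> = - ((a * (m * c + n * d) - b * (k * c + l * d)) * (c * b - d * a))"
  let ?X = "\<lambda>t. x \<otimes>\<^bsub>SL2\<^esub> transvection a b t" and ?Y = "\<lambda>s. y \<otimes>\<^bsub>SL2\<^esub> transvection c d s"
  have coll: "collinear_in (left_coset_blocks SL2 root_subgroups) (?X t) (?Y s)
      \<longleftrightarrow> \<kappa> t + s * (\<beta> + t * \<delta>) = 1 + 1" for s t
  proof -
    have "inv\<^bsub>SL2\<^esub> ?X t \<otimes>\<^bsub>SL2\<^esub> ?Y s
        = transvection a b (- t) \<otimes>\<^bsub>SL2\<^esub> (g \<otimes>\<^bsub>SL2\<^esub> transvection c d s)"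
      using x y by (simp add: SL2.inv_mult_group transvection_inv SL2.m_assoc g_def)
    moreover obtain k' l' m' n' where *:
      "transvection a b (- t) \<otimes>\<^bsub>SL2\<^esub> (g \<otimes>\<^bsub>SL2\<^esub> transvection c d s) = mat2 k' l' m' n'"
      "k' * n' - l' * m' = 1"
      using gc by (meson SL2.m_closed SL2_cases transvection_in_SL2)
    moreover have "k' + n' = \<kappa> t + s * (\<beta> + t * \<delta>)"
    proof -
      have kn: "k' = (1 + t * a * b) * (k * (1 - s * c * d) - l * (s * d * d))
          - t * a * a * (m * (1 - s * c * d) - n * (s * d * d))"
        "n' = t * b * b * (k * (s * c * c) + l * (1 + s * c * d))
          + (1 - t * a * b) * (m * (s * c * c) + n * (1 + s * c * d))"
        using *(1) by (simp_all add: g transvection_def SL2_mult mat2_mult)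
      show ?thesis unfolding kn \<kappa>_def \<beta>_def \<delta>_def by (simp add: algebra_simps)
    qed
    ultimately show ?thesis
      using x y in_some_root_subgroup_iff_trace[OF *(2)]
      by (simp add: collinear_in_root_cosets_iff)
  qed
  have X: "x <#\<^bsub>SL2\<^esub> T = range ?X" and Y: "y <#\<^bsub>SL2\<^esub> U = range ?Y"
    by (auto simp: ab cd root_subgroup_def l_coset_def)
  have inj: "inj ?Y" using y transvection_eq_iff[OF cd(2)] by (simp add: inj_def)
  have "(\<exists>!Y. Y \<in> y <#\<^bsub>SL2\<^esub> U \<and> collinear_in (left_coset_blocks SL2 root_subgroups) (?X t) Y)
      \<longleftrightarrow> (\<exists>!s. \<kappa> t + s * (\<beta> + t * \<delta>) = 1 + 1)" for t
    unfolding Y ex1_in_image_iff[OF inj] coll by simp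
  then have "uniformly_joined (left_coset_blocks SL2 root_subgroups) (x <#\<^bsub>SL2\<^esub> T) (y <#\<^bsub>SL2\<^esub> U)
    \<longleftrightarrow> (\<forall>t. \<beta> + t * \<delta> \<noteq> 0) \<or> (\<forall>t. \<beta> + t * \<delta> = 0)"
    by (simp add: uniformly_joined_def X affine_ex1_iff)
  also have "\<dots> \<longleftrightarrow> \<delta> = 0" by (rule affine_zero_everywhere_or_nowhere_iff)
  also have "\<dots> \<longleftrightarrow> c * b = d * a \<or> a * (m * c + n * d) = b * (k * c + l * d)"
    by (auto simp: \<delta>_def)
  also have "c * b = d * a \<longleftrightarrow> T = U"
    using root_subgroup_eq_iff[OF ab(2) cd(2)] by (auto simp: ab cd mult.commute)
  also have "a * (m * c + n * d) = b * (k * c + l * d) \<longleftrightarrow>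
      T = g <#\<^bsub>SL2\<^esub> U #>\<^bsub>SL2\<^esub> inv\<^bsub>SL2\<^esub> g"
    using root_subgroup_eq_iff[OF ab(2) SL2_apply_nonzero[OF det1 cd(2)]]
    by (simp add: ab cd g root_subgroup_conj[OF det1])
  also have "T = g <#\<^bsub>SL2\<^esub> U #>\<^bsub>SL2\<^esub> inv\<^bsub>SL2\<^esub> g \<longleftrightarrow>
      x <#\<^bsub>SL2\<^esub> T #>\<^bsub>SL2\<^esub> inv\<^bsub>SL2\<^esub> x = y <#\<^bsub>SL2\<^esub> U #>\<^bsub>SL2\<^esub> inv\<^bsub>SL2\<^esub> y"
  proof -
    have Ts: "T \<subseteq> carrier SL2" and Us: "U \<subseteq> carrier SL2"
      using subgroup.subset[OF subgroup_root_subgroup] ab(1) cd(1) by auto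
    have ix: "inv\<^bsub>SL2\<^esub> x \<in> carrier SL2" using x by simp
    have xg: "x \<otimes>\<^bsub>SL2\<^esub> g = y" using x y by (simp add: g_def SL2.inv_mult_cancel)
    have "inv\<^bsub>SL2\<^esub> x <#\<^bsub>SL2\<^esub> (x <#\<^bsub>SL2\<^esub> T #>\<^bsub>SL2\<^esub> inv\<^bsub>SL2\<^esub> x) #>\<^bsub>SL2\<^esub> inv\<^bsub>SL2\<^esub> (inv\<^bsub>SL2\<^esub> x) = T"
      using SL2.conj_mult[OF Ts ix x] SL2.conj_one[OF Ts] x by simp
    moreover have "inv\<^bsub>SL2\<^esub> x <#\<^bsub>SL2\<^esub> (y <#\<^bsub>SL2\<^esub> U #>\<^bsub>SL2\<^esub> inv\<^bsub>SL2\<^esub> y) #>\<^bsub>SL2\<^esub> inv\<^bsub>SL2\<^esub> (inv\<^bsub>SL2\<^esub> x)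
        = g <#\<^bsub>SL2\<^esub> U #>\<^bsub>SL2\<^esub> inv\<^bsub>SL2\<^esub> g"
      using SL2.conj_mult[OF Us ix y] by (simp add: g_def)
    moreover have "x <#\<^bsub>SL2\<^esub> (g <#\<^bsub>SL2\<^esub> U #>\<^bsub>SL2\<^esub> inv\<^bsub>SL2\<^esub> g) #>\<^bsub>SL2\<^esub> inv\<^bsub>SL2\<^esub> x
        = y <#\<^bsub>SL2\<^esub> U #>\<^bsub>SL2\<^esub> inv\<^bsub>SL2\<^esub> y"
      using SL2.conj_mult[OF Us x gc] xg by simp
    ultimately show ?thesis by metis
  qed
  finally show ?thesis .
qed

text \<open>Conjugating a non-central \<open>s \<in> S\<close> by the upper unitriangular matrices already gives \<open>q\<close>
  elements of \<open>S - {1}\<close> with the same nonzero lower left entry. Hence all elements of \<open>S - {1}\<close>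
  have this entry, but inversion changes its sign and conjugation by diagonal matrices scales it
  by squares.\<close>

lemma SL2_subgroup_of_order_Suc_q_not_normal:
  fixes S :: "('a::{field,finite}^2^2) set"
  assumes S: "subgroup S SL2" and card_S: "card S = CARD('a) + 1" and q3: "CARD('a) \<ge> 3"
    and disj: "\<And>T. T \<in> root_subgroups \<Longrightarrow> S \<inter> T \<subseteq> {\<one>\<^bsub>SL2\<^esub>}"
  shows "\<exists>g\<in>carrier SL2. \<exists>s\<in>S. g \<otimes>\<^bsub>SL2\<^esub> s \<otimes>\<^bsub>SL2\<^esub> inv\<^bsub>SL2\<^esub> g \<notin> S"
proof (rule ccontr)
  assume "\<not> ?thesis"
  then have normal: "g \<otimes>\<^bsub>SL2\<^esub> s \<otimes>\<^bsub>SL2\<^esub> inv\<^bsub>SL2\<^esub> g \<in> S" if "g \<in> carrier SL2" "s \<in> S" for g s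
    using that by blast
  interpret SL2: group "SL2 :: ('a^2^2) monoid" by (rule group_SL2)
  interpret S: subgroup S SL2 by (rule S)
  have upper: "mat2 1 b 0 1 \<in> S \<Longrightarrow> b = 0" for b
  proof -
    assume b: "mat2 1 b 0 1 \<in> S"
    have "mat2 1 b 0 1 = transvection 1 0 b" by (simp add: transvection_def)
    moreover have "root_subgroup 1 0 \<in> (root_subgroups :: ('a^2^2) set set)"
      unfolding root_subgroups_def by force
    ultimately have "mat2 1 b 0 1 = \<one>\<^bsub>SL2\<^esub>"
      using disj[of "root_subgroup 1 0"] b by (auto simp: root_subgroup_def)
    then show "b = 0" by (simp add: SL2_one)
  qed
  have sq1: "a = 1 \<or> a = - 1" if "a * a = 1" for a :: 'a
  proof -
    have "(a - 1) * (a + 1) = 0" using that by (simp add: algebra_simps)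
    then show ?thesis by (auto simp: eq_neg_iff_add_eq_0)
  qed
  \<comment> \<open>For a triangular s in S, dividing s by its conjugate under the unitriangular
    matrix with entry 1 gives a unitriangular element of S with entry \<open>a^2 - 1\<close>, so a
    is 1 or -1. Then s squared is unitriangular as well, whence \<open>b + b = 0\<close>.\<close>
  have lower: "c \<noteq> 0"
    if s: "mat2 a b c d \<in> S" and ne: "mat2 a b c d \<notin> {mat2 1 0 0 1, mat2 (- 1) 0 0 (- 1)}"
    for a b c d
  proof
    assume c: "c = 0"
    have ad: "a * d = 1" using s S.subset c by (auto simp: mat2_in_SL2)
    have "mat2 a b c d \<otimes>\<^bsub>SL2\<^esub> inv\<^bsub>SL2\<^esub> (mat2 1 1 0 1 \<otimes>\<^bsub>SL2\<^esub> mat2 a b c d \<otimes>\<^bsub>SL2\<^esub> inv\<^bsub>SL2\<^esub> mat2 1 1 0 1) \<in> S"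
      using s normal[of "mat2 1 1 0 1"] by (simp add: mat2_in_SL2)
    moreover have "mat2 a b c d \<otimes>\<^bsub>SL2\<^esub> inv\<^bsub>SL2\<^esub> (mat2 1 1 0 1 \<otimes>\<^bsub>SL2\<^esub> mat2 a b c d \<otimes>\<^bsub>SL2\<^esub> inv\<^bsub>SL2\<^esub> mat2 1 1 0 1)
      = mat2 1 (a * a - 1) 0 1"
    proof -
      have "mat2 1 1 0 1 \<otimes>\<^bsub>SL2\<^esub> mat2 a b c d \<otimes>\<^bsub>SL2\<^esub> inv\<^bsub>SL2\<^esub> mat2 1 1 0 1 = mat2 a (b + d - a) 0 d"
        by (simp add: c SL2_inv SL2_mult mat2_mult)
      then show ?thesis using ad by (simp add: c SL2_inv SL2_mult mat2_mult algebra_simps)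
    qed
    ultimately have "a * a = 1" using upper by fastforce
    then have a: "a = 1 \<or> a = - 1" by (rule sq1)
    have da: "d = a" using ad \<open>a * a = 1\<close> by (metis mult_cancel_left mult_zero_left zero_neq_one)
    have "mat2 a b c d \<otimes>\<^bsub>SL2\<^esub> mat2 a b c d \<in> S" using s by simp
    then have "mat2 1 (a * b + b * a) 0 1 \<in> S"
      using \<open>a * a = 1\<close> by (simp add: SL2_mult mat2_mult c da)
    then have ab: "a * (b + b) = 0" using upper by (fastforce simp: algebra_simps)
    then have bb: "b + b = 0" using a by auto
    show False
    proof (cases "(1::'a) + 1 = 0")
      \<comment> \<open>In characteristic 2 the equation \<open>b + b = 0\<close> says nothing about
        b, but a = d = 1 makes s itself unitriangular.\<close>
      case True
      then have "(- 1 :: 'a) = 1" by (simp add: eq_neg_iff_add_eq_0[symmetric])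
      then have "a = 1" using a by auto
      then show False using upper s ne c da by auto
    next
      case False
      have "b * (1 + 1) = 0" using bb by (simp only: ring_distribs mult_1_right)
      then have "b = 0" using False by (simp only: mult_eq_0_iff simp_thms)
      then show False using a da c ne by auto
    qed
  qed
  obtain s where s: "s \<in> S" "s \<notin> {mat2 1 0 0 1, mat2 (- 1) 0 0 (- 1)}"
  proof -
    have "card {mat2 1 0 0 1, mat2 (- 1) 0 0 (- 1 :: 'a)} \<le> 2" 
      by (simp add: card_insert_if)
    then have "\<not> S \<subseteq> {mat2 1 0 0 1, mat2 (- 1) 0 0 (- 1)}"
      using card_S q3 card_mono[of "{mat2 1 0 0 1, mat2 (- 1) 0 0 (- 1 :: 'a)}" S] by auto
    then show ?thesis using that by blast
  qed
  obtain a b c d where s_eq: "s = mat2 a b c d" and det1: "a * d - b * c = 1"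
    using s(1) S.subset SL2_cases by blast
  have c0: "c \<noteq> 0" using lower s s_eq by blast
  define f where "f t = mat2 1 t 0 1 \<otimes>\<^bsub>SL2\<^esub> s \<otimes>\<^bsub>SL2\<^esub> inv\<^bsub>SL2\<^esub> mat2 1 t 0 1" for t
  have f: "f t $ 1 $ 1 = a + t * c" "f t $ 2 $ 1 = c" for t
    by (simp_all add: f_def s_eq SL2_inv SL2_mult mat2_mult)
  have "inj f"
    using c0 f(1) by (metis add_left_cancel injI mult_cancel_right)
  then have "card (range f) = card (S - {\<one>\<^bsub>SL2\<^esub>})"
    using card_S by (simp add: card_image)
  moreover have "range f \<subseteq> S - {\<one>\<^bsub>SL2\<^esub>}"
  proof
    fix z assume "z \<in> range f"
    then obtain t where z: "z = f t" by blast
    have "f t \<in> S" using normal s(1) by (simp add: f_def mat2_in_SL2)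
    moreover have "f t \<noteq> \<one>\<^bsub>SL2\<^esub>" using f(2)[of t] c0 by (auto simp: SL2_one)
    ultimately show "z \<in> S - {\<one>\<^bsub>SL2\<^esub>}" by (simp add: z)
  qed
  ultimately have all: "S - {\<one>\<^bsub>SL2\<^esub>} = range f" by (metis card_subset_eq finite)
  have entry: "z $ 2 $ 1 = c" if "z \<in> S" "z $ 2 $ 1 \<noteq> 0" for z
  proof -
    have "z \<noteq> \<one>\<^bsub>SL2\<^esub>" using that(2) by (auto simp: SL2_one)
    then have "z \<in> range f" using that(1) all by blast
    then show ?thesis using f(2) by auto
  qed
  have "inv\<^bsub>SL2\<^esub> s \<in> S" "(inv\<^bsub>SL2\<^esub> s) $ 2 $ 1 = - c"
    using S.m_inv_closed[OF s(1)] det1 by (simp_all add: s_eq SL2_inv)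
  then have minus_c: "- c = c" using entry c0 by (metis neg_equal_0_iff_equal)
  have "\<not> (UNIV :: 'a set) \<subseteq> {0, 1}"
  proof
    assume "(UNIV :: 'a set) \<subseteq> {0, 1}"
    then have "CARD('a) \<le> card {0, 1 :: 'a}" by (intro card_mono) auto
    then show False using q3 by simp
  qed
  \<comment> \<open>Such k exists as \<open>q \<ge> 3\<close>. Conjugation by diag(k, 1/k) divides
    the lower left entry by \<open>k^2\<close>, so \<open>k^2 = 1\<close>; since
    \<open>minus_c\<close> forces characteristic 2, this leaves only k = 1.\<close>
  then obtain k :: 'a where k: "k \<noteq> 0" "k \<noteq> 1" by auto
  have "mat2 k 0 0 (1 / k) \<otimes>\<^bsub>SL2\<^esub> s \<otimes>\<^bsub>SL2\<^esub> inv\<^bsub>SL2\<^esub> mat2 k 0 0 (1 / k) \<in> S"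
    using normal s(1) k by (simp add: mat2_in_SL2)
  moreover have "(mat2 k 0 0 (1 / k) \<otimes>\<^bsub>SL2\<^esub> s \<otimes>\<^bsub>SL2\<^esub> inv\<^bsub>SL2\<^esub> mat2 k 0 0 (1 / k)) $ 2 $ 1 = c / (k * k)"
    using k by (simp add: s_eq SL2_inv SL2_mult mat2_mult)
  ultimately have "c / (k * k) = c" using entry c0 k by (metis divide_eq_0_iff mult_eq_0_iff)
  then have "k * k = 1" using c0 k by (simp add: field_simps)
  moreover have "(- 1 :: 'a) = 1"
  proof -
    have "(- 1) * c = 1 * c" using minus_c by simp
    then show ?thesis using c0 by (simp only: mult_cancel_right simp_thms)
  qed
  ultimately show False using sq1[of k] k by auto
qed

section \<open>Inversion and quotient sets of cosets\<close>

context group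
begin

lemma inv_image_subgroup:
  assumes "subgroup T G"
  shows "(\<lambda>x. inv x) ` T = T"
proof -
  interpret T: subgroup T G by fact
  show ?thesis
  proof (intro equalityI subsetI)
    fix t assume "t \<in> T"
    then have "t = inv (inv t)" "inv t \<in> T" by simp_all
    then show "t \<in> (\<lambda>x. inv x) ` T" by blast
  qed auto
qed

lemma inv_image_r_coset:
  assumes "subgroup T G" "x \<in> carrier G"
  shows "(\<lambda>y. inv y) ` (T #> x) = inv x <# T"
proof -
  have "(\<lambda>y. inv y) ` (T #> x) = inv x <# ((\<lambda>y. inv y) ` T)"
    using subgroup.subset[OF assms(1)] assms(2)
    by (force simp: r_coset_def l_coset_def inv_mult_group)
  then show ?thesis by (simp add: inv_image_subgroup[OF assms(1)])
qed

lemma inv_image_l_coset: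
  assumes "subgroup T G" "x \<in> carrier G"
  shows "(\<lambda>y. inv y) ` (x <# T) = T #> inv x"
proof -
  have "(\<lambda>y. inv y) ` (x <# T) = ((\<lambda>y. inv y) ` T) #> inv x"
    using subgroup.subset[OF assms(1)] assms(2)
    by (force simp: r_coset_def l_coset_def inv_mult_group)
  then show ?thesis by (simp add: inv_image_subgroup[OF assms(1)])
qed

lemma card_r_coset:
  assumes "A \<subseteq> carrier G" "g \<in> carrier G"
  shows "card (A #> g) = card A"
proof -
  have "A #> g = (\<lambda>a. a \<otimes> g) ` A" by (auto simp: r_coset_def)
  moreover have "inj_on (\<lambda>a. a \<otimes> g) A" 
    using assms by (intro inj_onI) (metis right_cancel subsetD)
  ultimately show ?thesis by (simp add: card_image)
qed

lemma card_l_coset: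
  assumes "A \<subseteq> carrier G" "g \<in> carrier G"
  shows "card (g <# A) = card A"
proof -
  have "g <# A = (\<lambda>a. g \<otimes> a) ` A" by (auto simp: l_coset_def)
  moreover have "inj_on (\<lambda>a. g \<otimes> a) A"
    by (rule inj_on_inverseI[where g = "\<lambda>a. inv g \<otimes> a"]) (use assms in \<open>auto simp: inv_mult_cancel\<close>)
  ultimately show ?thesis by (simp add: card_image)
qed

lemma quotients_r_coset:
  assumes "A \<subseteq> carrier G" "g \<in> carrier G"
  shows "quotients G (A #> g) = quotients G A"
proof -
  have "x \<otimes> g \<otimes> inv (y \<otimes> g) = x \<otimes> inv y" "x \<otimes> g = y \<otimes> g \<longleftrightarrow> x = y" if "x \<in> A" "y \<in> A" for x y
  proof -
    have "x \<in> carrier G" "y \<in> carrier G" using that assms(1) by auto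
    then show "x \<otimes> g \<otimes> inv (y \<otimes> g) = x \<otimes> inv y" "x \<otimes> g = y \<otimes> g \<longleftrightarrow> x = y"
      using assms(2) by (simp_all add: inv_mult_group m_assoc inv_mult_cancel)
  qed
  then show ?thesis unfolding quotients_def r_coset_def by (auto; metis)
qed

text \<open>A subgroup of order \<open>q + 1\<close> thus has at most q quotients, fewer than the
  \<open>q (q + 1)\<close> of a member of \<D>; this separates subgroups from translates of such
  members.\<close>

lemma quotients_subgroup:
  assumes "subgroup K G"
  shows "quotients G K \<subseteq> K - {\<one>}"
proof -
  interpret K: subgroup K G by fact
  show ?thesis
  proof
    fix z assume "z \<in> quotients G K"
    then obtain x y where xy: "x \<in> K" "y \<in> K" "x \<noteq> y" "z = x \<otimes> inv y"
      by (auto simp: quotients_def)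
    then have "x \<otimes> inv y \<noteq> \<one>" using inv_equality[of x "inv y"] by auto
    then show "z \<in> K - {\<one>}" using xy by simp
  qed
qed

end

text \<open>Inversion fixes each subgroup as a set and exchanges its left and right cosets. If
  \<psi> swaps the sides, following it by inversion gives a map that preserves them, and
  \<open>hom_if_preserves_cosets\<close> covers both cases.\<close>

lemma root_coset_permutation_hom_or_antihom:
  fixes \<psi> :: "'a::field^2^2 \<Rightarrow> 'a^2^2"
  assumes bij: "bij_betw \<psi> (carrier SL2) (carrier SL2)" and one: "\<psi> \<one>\<^bsub>SL2\<^esub> = \<one>\<^bsub>SL2\<^esub>"
    and blocks: "(`) \<psi> ` left_coset_blocks SL2 root_subgroups = left_coset_blocks SL2 root_subgroups"
  shows "\<psi> \<in> hom SL2 SL2 \<or> (\<lambda>x. inv\<^bsub>SL2\<^esub> \<psi> x) \<in> hom SL2 SL2"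
proof -
  interpret SL2: group "SL2 :: ('a^2^2) monoid" by (rule group_SL2)
  have mem: "root_subgroup 1 0 \<in> (root_subgroups :: ('a^2^2) set set)"
    "root_subgroup 0 1 \<in> (root_subgroups :: ('a^2^2) set set)"
    unfolding root_subgroups_def by force+
  have ne: "root_subgroup 1 0 \<noteq> (root_subgroup 0 1 :: ('a^2^2) set)"
    using root_subgroup_eq_iff[of 1 0 0 "1::'a"] by simp
  have trans: "\<exists>x\<in>carrier SL2. x <#\<^bsub>SL2\<^esub> T #>\<^bsub>SL2\<^esub> inv\<^bsub>SL2\<^esub> x = U"
    if "T \<in> root_subgroups" "U \<in> root_subgroups" for T U :: "('a^2^2) set"
    using root_subgroups_conj_transitive[OF that] by metis
  note preserved_or_swapped = SL2.coset_blocks_preserved_or_swapped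
    [OF subgroup_root_subgroups root_subgroups_conj_closed trans mem ne
      uniformly_joined_root_cosets_iff bij one blocks]
  have P: "(`) \<psi> ` root_subgroups = root_subgroups" by (rule preserved_or_swapped(1))
  have clos: "\<psi> x \<in> carrier SL2" if "x \<in> carrier SL2" for x
    using bij_betwE[OF bij] that by blast
  have hom: "\<phi> \<in> hom SL2 SL2"
    if "\<And>x. x \<in> carrier SL2 \<Longrightarrow> \<phi> x \<in> carrier SL2" "(`) \<phi> ` root_subgroups = root_subgroups"
      "\<And>T x. T \<in> root_subgroups \<Longrightarrow> x \<in> carrier SL2 \<Longrightarrow> \<phi> ` (x <#\<^bsub>SL2\<^esub> T) = \<phi> x <#\<^bsub>SL2\<^esub> \<phi> ` T"
      "\<And>T x. T \<in> root_subgroups \<Longrightarrow> x \<in> carrier SL2 \<Longrightarrow> \<phi> ` (T #>\<^bsub>SL2\<^esub> x) = \<phi> ` T #>\<^bsub>SL2\<^esub> \<phi> x"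
    for \<phi> :: "'a^2^2 \<Rightarrow> 'a^2^2"
    by (rule SL2.hom_if_preserves_cosets[OF subgroup_root_subgroups root_subgroups_conj_closed
          root_subgroup_normalizing_all_trivial SL2_generated_by_root_subgroups that])
  from preserved_or_swapped(2) show ?thesis
  proof
    assume "\<forall>T\<in>root_subgroups. \<forall>x\<in>carrier SL2. \<psi> ` (x <#\<^bsub>SL2\<^esub> T) = \<psi> x <#\<^bsub>SL2\<^esub> \<psi> ` T
          \<and> \<psi> ` (T #>\<^bsub>SL2\<^esub> x) = \<psi> ` T #>\<^bsub>SL2\<^esub> \<psi> x"
    then show ?thesis using hom[OF clos P] by simp
  next
    assume swap: "\<forall>T\<in>root_subgroups. \<forall>x\<in>carrier SL2. \<psi> ` (x <#\<^bsub>SL2\<^esub> T) = \<psi> ` T #>\<^bsub>SL2\<^esub> \<psi> x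
          \<and> \<psi> ` (T #>\<^bsub>SL2\<^esub> x) = \<psi> x <#\<^bsub>SL2\<^esub> \<psi> ` T"
    let ?phi = "\<lambda>x. inv\<^bsub>SL2\<^esub> \<psi> x"
    have im: "?phi ` A = (\<lambda>y. inv\<^bsub>SL2\<^esub> y) ` \<psi> ` A" for A by (simp add: image_image)
    have sub: "subgroup (\<psi> ` T) SL2" if "T \<in> root_subgroups" for T
      using subgroup_root_subgroups P that by blast
    have phi_T: "?phi ` T = \<psi> ` T" if "T \<in> root_subgroups" for T
      unfolding im by (rule SL2.inv_image_subgroup[OF sub[OF that]])
    have "?phi \<in> hom SL2 SL2"
    proof (rule hom)
      show "(`) ?phi ` root_subgroups = root_subgroups"
        using P phi_T by (metis (no_types, lifting) image_cong)
      fix T :: "('a^2^2) set" and x :: "'a^2^2"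
      assume T: "T \<in> root_subgroups" and x: "x \<in> carrier SL2"
      have "\<psi> ` (x <#\<^bsub>SL2\<^esub> T) = \<psi> ` T #>\<^bsub>SL2\<^esub> \<psi> x" "\<psi> ` (T #>\<^bsub>SL2\<^esub> x) = \<psi> x <#\<^bsub>SL2\<^esub> \<psi> ` T"
        using swap T x by auto
      then show "?phi ` (x <#\<^bsub>SL2\<^esub> T) = ?phi x <#\<^bsub>SL2\<^esub> ?phi ` T"
        "?phi ` (T #>\<^bsub>SL2\<^esub> x) = ?phi ` T #>\<^bsub>SL2\<^esub> ?phi x"
        unfolding phi_T[OF T] unfolding im
        using SL2.inv_image_r_coset[OF sub[OF T] clos[OF x]]
          SL2.inv_image_l_coset[OF sub[OF T] clos[OF x]] by simp_all
    qed (use clos in simp)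
    then show ?thesis by blast
  qed
qed

section \<open>Blocks of an affine unital\<close>

locale SL2_unital_structure =
  fixes p e :: nat and S :: "('a::{field,finite}^2^2) set" and \<D> :: "('a^2^2) set set"
  assumes prime: "prime p" and card_field: "CARD('a) = p ^ e"
    and unital: "affine_SL2_unital p S \<D>"
begin

abbreviation "blocks \<equiv> snd (SL2_unital p S \<D>)"

sublocale SL2: group "SL2 :: ('a^2^2) monoid" by (rule group_SL2)

lemma S: "subgroup S SL2" and card_S: "card S = CARD('a) + 1"
  using unital by (simp_all add: affine_SL2_unital_def)

lemma D_block:
  assumes "D \<in> \<D>"
  shows "D \<subseteq> carrier SL2" "card D = CARD('a) + 1"
    "card (quotients SL2 D) = CARD('a) * (CARD('a) + 1)"
  using unital assms by (auto simp: affine_SL2_unital_def)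

lemma blocks_eq:
  "blocks = {B #>\<^bsub>SL2\<^esub> g | B g. B \<in> {S} \<union> root_subgroups \<union> \<D> \<and> g \<in> carrier SL2}"
  unfolding SL2_unital_def sylow_subgroups_SL2[OF prime card_field] snd_conv by blast

lemma base_block_subset: "B \<in> {S} \<union> root_subgroups \<union> \<D> \<Longrightarrow> B \<subseteq> carrier SL2"
  using subgroup.subset[OF S] subgroup.subset[OF subgroup_root_subgroups, of B] D_block(1)[of B]
  by auto

lemma block_subset:
  assumes "B \<in> blocks"
  shows "B \<subseteq> carrier SL2"
proof -
  obtain C g where "C \<in> {S} \<union> root_subgroups \<union> \<D>" "g \<in> carrier SL2" "B = C #>\<^bsub>SL2\<^esub> g"
    using assms unfolding blocks_eq by blast
  then show ?thesis using SL2.r_coset_subset_G[OF base_block_subset] by simp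
qed

lemma block_r_coset:
  assumes "B \<in> blocks" "h \<in> carrier SL2"
  shows "B #>\<^bsub>SL2\<^esub> h \<in> blocks"
proof -
  obtain C g where C: "C \<in> {S} \<union> root_subgroups \<union> \<D>" "g \<in> carrier SL2" "B = C #>\<^bsub>SL2\<^esub> g"
    using assms(1) unfolding blocks_eq by blast
  then have "B #>\<^bsub>SL2\<^esub> h = C #>\<^bsub>SL2\<^esub> (g \<otimes>\<^bsub>SL2\<^esub> h)"
    using SL2.coset_mult_assoc base_block_subset assms(2) by metis
  then show ?thesis using C assms(2) unfolding blocks_eq by blast
qed

text \<open>Translation keeps sizes, S and the members of \<D> have size \<open>q + 1\<close>, and a
  right coset of T is a left coset of a conjugate. The right-hand side is independent of S and \<D>,
  so an isomorphism between two unitals permutes one fixed family.\<close>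

lemma short_blocks: "{B \<in> blocks. card B = CARD('a)} = left_coset_blocks SL2 root_subgroups"
proof -
  have card_r: "card (B #>\<^bsub>SL2\<^esub> g) = card B"
    if "B \<in> {S} \<union> root_subgroups \<union> \<D>" "g \<in> carrier SL2" for B g
    using that SL2.card_r_coset base_block_subset by blast
  have "{B \<in> blocks. card B = CARD('a)} = {T #>\<^bsub>SL2\<^esub> g | T g. T \<in> root_subgroups \<and> g \<in> carrier SL2}"
  proof (intro equalityI subsetI)
    fix B assume "B \<in> {B \<in> blocks. card B = CARD('a)}"
    then obtain C g where C: "C \<in> {S} \<union> root_subgroups \<union> \<D>" "g \<in> carrier SL2"
      "B = C #>\<^bsub>SL2\<^esub> g" "card B = CARD('a)" unfolding blocks_eq by blast
    then have "card C = CARD('a)" using card_r by simp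
    then have "C \<in> root_subgroups" using C(1) card_S D_block(2) by fastforce
    then show "B \<in> {T #>\<^bsub>SL2\<^esub> g | T g. T \<in> root_subgroups \<and> g \<in> carrier SL2}" using C by blast
  next
    fix B assume "B \<in> {T #>\<^bsub>SL2\<^esub> g | T g. T \<in> root_subgroups \<and> g \<in> carrier (SL2 :: ('a^2^2) monoid)}"
    then obtain T g where "B = T #>\<^bsub>SL2\<^esub> g" "T \<in> root_subgroups" "g \<in> carrier SL2" by blast
    then show "B \<in> {B \<in> blocks. card B = CARD('a)}"
      using card_r[of T g] card_root_subgroups[of T] unfolding blocks_eq by auto
  qed
  also have "\<dots> = left_coset_blocks SL2 root_subgroups"
  proof (intro equalityI subsetI)
    fix B assume "B \<in> {T #>\<^bsub>SL2\<^esub> g | T g. T \<in> root_subgroups \<and> g \<in> carrier (SL2 :: ('a^2^2) monoid)}"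
    then obtain T g where T: "B = T #>\<^bsub>SL2\<^esub> g" "T \<in> root_subgroups" "g \<in> carrier SL2" by blast
    have "B = g <#\<^bsub>SL2\<^esub> (inv\<^bsub>SL2\<^esub> g <#\<^bsub>SL2\<^esub> T #>\<^bsub>SL2\<^esub> g)"
      using SL2.r_coset_eq_l_coset_conj T base_block_subset by blast
    moreover have "inv\<^bsub>SL2\<^esub> g <#\<^bsub>SL2\<^esub> T #>\<^bsub>SL2\<^esub> g \<in> root_subgroups"
      using root_subgroups_conj_closed[OF SL2.inv_closed[OF T(3)] T(2)] T(3) by simp
    ultimately show "B \<in> left_coset_blocks SL2 root_subgroups"
      using T(3) unfolding left_coset_blocks_def by blast
  next
    fix B :: "('a^2^2) set" assume "B \<in> left_coset_blocks SL2 root_subgroups"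
    then obtain T g where T: "B = g <#\<^bsub>SL2\<^esub> T" "T \<in> root_subgroups" "g \<in> carrier SL2"
      unfolding left_coset_blocks_def by blast
    then have "B = (g <#\<^bsub>SL2\<^esub> T #>\<^bsub>SL2\<^esub> inv\<^bsub>SL2\<^esub> g) #>\<^bsub>SL2\<^esub> g"
      using SL2.l_coset_eq_r_coset_conj base_block_subset by blast
    then show "B \<in> {T #>\<^bsub>SL2\<^esub> g | T g. T \<in> root_subgroups \<and> g \<in> carrier SL2}"
      using root_subgroups_conj_closed[OF T(3,2)] T(3) by blast
  qed
  finally show ?thesis .
qed

text \<open>Size excludes the short blocks and the number of quotients excludes translates of
  members of \<D>. A coset \<open>S g\<close> has right quotients S, and a subgroup is its own set
  of right quotients.\<close>

lemma subgroup_block_eq_S: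
  assumes "subgroup K SL2" "card K = CARD('a) + 1" "K \<in> blocks"
  shows "K = S"
proof -
  obtain B g where B: "B \<in> {S} \<union> root_subgroups \<union> \<D>" "g \<in> carrier SL2" "K = B #>\<^bsub>SL2\<^esub> g"
    using assms(3) unfolding blocks_eq by blast
  have "card B = CARD('a) + 1"
    using SL2.card_r_coset[OF base_block_subset[OF B(1)] B(2)] B(3) assms(2) by simp
  then have "B \<notin> root_subgroups" using card_root_subgroups[of B] by auto
  moreover have "B \<notin> \<D>"
  proof
    assume "B \<in> \<D>"
    then have "card (quotients SL2 K) = CARD('a) * (CARD('a) + 1)"
      using SL2.quotients_r_coset[OF base_block_subset[OF B(1)] B(2)] B(3) D_block(3) by simp
    moreover have "card (quotients SL2 K) \<le> card (K - {\<one>\<^bsub>SL2\<^esub>})"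
      by (intro card_mono SL2.quotients_subgroup assms(1)) simp
    moreover have "card (K - {\<one>\<^bsub>SL2\<^esub>}) = CARD('a)"
      using subgroup.one_closed[OF assms(1)] assms(2) by simp
    ultimately show False by simp
  qed
  ultimately have "K = S #>\<^bsub>SL2\<^esub> g" using B by blast
  then have "right_quotients SL2 K = S" using SL2.right_quotients_r_coset[OF S B(2)] by simp
  moreover have "right_quotients SL2 K = K"
    using SL2.right_quotients_r_coset[OF assms(1) SL2.one_closed]
      SL2.coset_mult_one[OF subgroup.subset[OF assms(1)]] by simp
  ultimately show ?thesis by simp
qed

text \<open>Disjointness in a partition concerns distinct parts only, so the parts from S and T are
  first told apart by their sizes q and \<open>q - 1\<close>.\<close>

lemma S_inter_root_subgroup:
  assumes "T \<in> root_subgroups"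
  shows "S \<inter> T \<subseteq> {\<one>\<^bsub>SL2\<^esub>}"
proof -
  have "T \<in> sylow_subgroups p SL2"
    using assms sylow_subgroups_SL2[OF prime card_field] by simp
  moreover have "S - {\<one>\<^bsub>SL2\<^esub>} \<noteq> T - {\<one>\<^bsub>SL2\<^esub>}"
  proof
    assume eq: "S - {\<one>\<^bsub>SL2\<^esub>} = T - {\<one>\<^bsub>SL2\<^esub>}"
    have "card (S - {\<one>\<^bsub>SL2\<^esub>}) = CARD('a)"
      using card_S subgroup.one_closed[OF S] by simp
    moreover have "card (T - {\<one>\<^bsub>SL2\<^esub>}) = CARD('a) - 1"
      using card_root_subgroups[OF assms] subgroup.one_closed[OF subgroup_root_subgroups[OF assms]]
      by simp
    \<comment> \<open>Subtraction on naturals is truncated: without positivity \<open>q - 1\<close>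
      could equal q.\<close>
    moreover have "CARD('a) > 0" by (rule finite_UNIV_card_ge_0) simp
    moreover have "card (S - {\<one>\<^bsub>SL2\<^esub>}) = card (T - {\<one>\<^bsub>SL2\<^esub>})" using eq by simp
    ultimately show False by linarith
  qed
  moreover have "disjoint ({S - {\<one>\<^bsub>SL2\<^esub>}} \<union> {T - {\<one>\<^bsub>SL2\<^esub>} | T. T \<in> sylow_subgroups p SL2}
      \<union> quotients SL2 ` \<D>)" (is "disjoint ?parts")
    using unital by (simp add: affine_SL2_unital_def partition_on_def)
  moreover have "S - {\<one>\<^bsub>SL2\<^esub>} \<in> ?parts" by blast
  moreover have "T - {\<one>\<^bsub>SL2\<^esub>} \<in> ?parts" using calculation(1) by blast
  ultimately have "(S - {\<one>\<^bsub>SL2\<^esub>}) \<inter> (T - {\<one>\<^bsub>SL2\<^esub>}) = {}" by (intro disjointD)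
  then show ?thesis by blast
qed

end

lemma incidence_iso_blocks_of_card:
  assumes "incidence_iso U V \<psi>" "\<And>B. B \<in> snd U \<Longrightarrow> B \<subseteq> fst U"
  shows "(`) \<psi> ` {B \<in> snd U. card B = n} = {B \<in> snd V. card B = n}"
proof -
  have inj: "inj_on \<psi> (fst U)" and im: "(`) \<psi> ` snd U = snd V"
    using assms(1) by (auto simp: incidence_iso_def bij_betw_def)
  have "card (\<psi> ` B) = card B" if "B \<in> snd U" for B
    using card_image inj_on_subset[OF inj assms(2)[OF that]] by blast
  then show ?thesis unfolding im[symmetric] by auto
qed

section \<open>Isomorphisms of unitals\<close>

lemma fst_SL2_unital [simp]: "fst (SL2_unital p S \<D>) = carrier SL2"
  by (simp add: SL2_unital_def)

text \<open>If the normalized isomorphism were an anti-automorphism, it would turn the right cosets of \<open>S\<close>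
  into left cosets, so that \<open>S'\<close> would be normal.\<close>

lemma SL2_unital_iso_fixing_one:
  fixes S S' :: "('a::{field,finite}^2^2) set"
  assumes U: "SL2_unital_structure p e S \<D>" and U': "SL2_unital_structure p e S' \<D>'"
    and q3: "CARD('a) \<ge> 3"
    and iso: "incidence_iso (SL2_unital p S \<D>) (SL2_unital p S' \<D>') \<psi>"
    and one: "\<psi> \<one>\<^bsub>SL2\<^esub> = \<one>\<^bsub>SL2\<^esub>"
  shows "\<psi> \<in> hom SL2 SL2" "\<psi> ` S = S'"
proof -
  interpret SL2: group "SL2 :: ('a^2^2) monoid" by (rule group_SL2)
  interpret U: SL2_unital_structure p e S \<D> by (rule U)
  interpret U': SL2_unital_structure p e S' \<D>' by (rule U')
  have bij: "bij_betw \<psi> (carrier SL2) (carrier SL2)" and im: "(`) \<psi> ` U.blocks = U'.blocks"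
    using iso by (simp_all add: incidence_iso_def)
  have clos: "\<psi> x \<in> carrier SL2" if "x \<in> carrier SL2" for x
    using bij_betwE[OF bij] that by blast
  have short: "(`) \<psi> ` left_coset_blocks SL2 root_subgroups = left_coset_blocks SL2 root_subgroups"
    using incidence_iso_blocks_of_card[OF iso, of "CARD('a)"] U.block_subset
    unfolding U.short_blocks U'.short_blocks by simp
  have S_blocks: "S #>\<^bsub>SL2\<^esub> g \<in> U.blocks" if "g \<in> carrier SL2" for g
    using that unfolding U.blocks_eq by blast
  have card_image_S: "card (\<psi> ` S) = CARD('a) + 1"
    using card_image[OF inj_on_subset[OF bij_betw_imp_inj_on[OF bij] subgroup.subset[OF U.S]]] U.card_S
    by simp
  have image_hom: "\<psi> ` S = S'" if hom: "\<psi> \<in> hom SL2 SL2"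
  proof (rule U'.subgroup_block_eq_S)
    interpret group_hom SL2 SL2 \<psi>
      using hom by (intro group_hom.intro group_hom_axioms.intro group_SL2)
    show "subgroup (\<psi> ` S) SL2" by (rule subgroup_img_is_subgroup[OF U.S])
    have "S \<in> U.blocks"
      using S_blocks[OF SL2.one_closed] SL2.coset_mult_one[OF subgroup.subset[OF U.S]] by simp
    then show "\<psi> ` S \<in> U'.blocks" using im by blast
  qed (rule card_image_S)
  have "\<psi> \<in> hom SL2 SL2"
  proof (rule ccontr)
    assume "\<psi> \<notin> hom SL2 SL2"
    then have phi: "(\<lambda>x. inv\<^bsub>SL2\<^esub> \<psi> x) \<in> hom SL2 SL2"
      using root_coset_permutation_hom_or_antihom[OF bij one short] by blast
    define \<phi> where "\<phi> = (\<lambda>x. inv\<^bsub>SL2\<^esub> \<psi> x)"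
    interpret group_hom SL2 SL2 \<phi>
      using phi unfolding \<phi>_def by (intro group_hom.intro group_hom_axioms.intro group_SL2)
    define K where "K = \<phi> ` S"
    have K: "subgroup K SL2" unfolding K_def by (rule subgroup_img_is_subgroup[OF U.S])
    have "inj_on (\<lambda>x. inv\<^bsub>SL2\<^esub> x) (\<psi> ` S)"
      using clos subgroup.subset[OF U.S] by (intro inj_onI) (metis SL2.inv_inv imageE subsetD)
    then have card_K: "card K = CARD('a) + 1"
      using card_image card_image_S unfolding K_def \<phi>_def by (metis image_image)
    \<comment> \<open>The homomorphism \<phi> sends \<open>S g\<close> to
      \<open>K \<phi>(g)\<close>, and inverting gives \<open>y K\<close> with
      \<open>y = \<psi> g\<close>. Surjectivity of \<psi> makes every left coset of K a
      block.\<close>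
    have left_block: "y <#\<^bsub>SL2\<^esub> K \<in> U'.blocks" if y: "y \<in> carrier SL2" for y
    proof -
      obtain g where g: "g \<in> carrier SL2" "\<psi> g = y"
        using y bij_betw_imp_surj_on[OF bij] by (metis imageE)
      have iy: "inv\<^bsub>SL2\<^esub> y \<in> carrier SL2" using y by simp
      have "\<psi> ` (S #>\<^bsub>SL2\<^esub> g) = (\<lambda>z. inv\<^bsub>SL2\<^esub> z) ` \<phi> ` (S #>\<^bsub>SL2\<^esub> g)"
        unfolding image_image
      proof (rule image_cong[OF refl])
        fix x assume "x \<in> S #>\<^bsub>SL2\<^esub> g"
        then have "x \<in> carrier SL2"
          using SL2.r_coset_subset_G[OF subgroup.subset[OF U.S] g(1)] by blast
        then show "\<psi> x = inv\<^bsub>SL2\<^esub> \<phi> x" using clos by (simp add: \<phi>_def)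
      qed
      also have "\<phi> ` (S #>\<^bsub>SL2\<^esub> g) = K #>\<^bsub>SL2\<^esub> \<phi> g"
      proof -
        have "\<phi> (s \<otimes>\<^bsub>SL2\<^esub> g) = \<phi> s \<otimes>\<^bsub>SL2\<^esub> \<phi> g" if "s \<in> S" for s
          using hom_mult subgroup.subset[OF U.S] that g(1) by blast
        then show ?thesis unfolding K_def r_coset_def by (auto simp: image_UN)
      qed
      also have "(\<lambda>z. inv\<^bsub>SL2\<^esub> z) ` (K #>\<^bsub>SL2\<^esub> \<phi> g) = y <#\<^bsub>SL2\<^esub> K"
        using SL2.inv_image_r_coset[OF K iy] g y by (simp add: \<phi>_def)
      finally have "y <#\<^bsub>SL2\<^esub> K = \<psi> ` (S #>\<^bsub>SL2\<^esub> g)" by simp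
      then show ?thesis using S_blocks[OF g(1)] im by blast
    qed
    \<comment> \<open>Each conjugate of K is a right translate of the block \<open>y K\<close>, and
      a subgroup of order \<open>q + 1\<close>, so it is S'. With y = 1 this gives K = S', and S'
      would be normal.\<close>
    have conj: "y <#\<^bsub>SL2\<^esub> K #>\<^bsub>SL2\<^esub> inv\<^bsub>SL2\<^esub> y = S'" if y: "y \<in> carrier SL2" for y
    proof (rule U'.subgroup_block_eq_S)
      have iy: "inv\<^bsub>SL2\<^esub> y \<in> carrier SL2" using y by simp
      show sub: "subgroup (y <#\<^bsub>SL2\<^esub> K #>\<^bsub>SL2\<^esub> inv\<^bsub>SL2\<^esub> y) SL2"
        using SL2.subgroup_conjugation_is_surj1[OF iy K] y by simp
      show "y <#\<^bsub>SL2\<^esub> K #>\<^bsub>SL2\<^esub> inv\<^bsub>SL2\<^esub> y \<in> U'.blocks"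
        by (rule U'.block_r_coset[OF left_block[OF y] iy])
      have "card (y <#\<^bsub>SL2\<^esub> K #>\<^bsub>SL2\<^esub> inv\<^bsub>SL2\<^esub> y) = card (y <#\<^bsub>SL2\<^esub> K)"
        by (rule SL2.card_r_coset[OF SL2.l_coset_subset_G[OF subgroup.subset[OF K] y] iy])
      also have "\<dots> = card K" by (rule SL2.card_l_coset[OF subgroup.subset[OF K] y])
      finally show "card (y <#\<^bsub>SL2\<^esub> K #>\<^bsub>SL2\<^esub> inv\<^bsub>SL2\<^esub> y) = CARD('a) + 1" using card_K by simp
    qed
    have "K = S'" using conj[OF SL2.one_closed] SL2.conj_one[OF subgroup.subset[OF K]] by simp
    moreover obtain g s where gs: "g \<in> carrier SL2" "s \<in> S'"
      "g \<otimes>\<^bsub>SL2\<^esub> s \<otimes>\<^bsub>SL2\<^esub> inv\<^bsub>SL2\<^esub> g \<notin> S'"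
      using SL2_subgroup_of_order_Suc_q_not_normal[OF U'.S U'.card_S q3 U'.S_inter_root_subgroup] by blast
    moreover have "g \<otimes>\<^bsub>SL2\<^esub> s \<otimes>\<^bsub>SL2\<^esub> inv\<^bsub>SL2\<^esub> g \<in> g <#\<^bsub>SL2\<^esub> S' #>\<^bsub>SL2\<^esub> inv\<^bsub>SL2\<^esub> g"
      using gs(2) by (auto simp: l_coset_def r_coset_def)
    ultimately show False using conj[OF gs(1)] by simp
  qed
  then show "\<psi> \<in> hom SL2 SL2" "\<psi> ` S = S'" using image_hom by simp_all
qed

text \<open>Right translations permute the blocks of any such unital, so translating by the inverse
  of \<open>\<psi> \<one>\<close> reduces to an isomorphism fixing the identity.\<close>

lemma SL2_unital_iso_decomposition:
  fixes S S' :: "('a::{field,finite}^2^2) set"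
  assumes U: "SL2_unital_structure p e S \<D>" and U': "SL2_unital_structure p e S' \<D>'"
    and q3: "CARD('a) \<ge> 3"
    and iso: "incidence_iso (SL2_unital p S \<D>) (SL2_unital p S' \<D>') \<psi>"
  shows "\<exists>h\<in>carrier SL2. \<exists>\<alpha>\<in>auto SL2. \<alpha> ` S = S' \<and>
    (\<forall>x\<in>carrier SL2. \<psi> x = right_translation SL2 h (\<alpha> x))"
proof -
  interpret SL2: group "SL2 :: ('a^2^2) monoid" by (rule group_SL2)
  interpret U: SL2_unital_structure p e S \<D> by (rule U)
  interpret U': SL2_unital_structure p e S' \<D>' by (rule U')
  have bij: "bij_betw \<psi> (carrier SL2) (carrier SL2)" and im: "(`) \<psi> ` U.blocks = U'.blocks"
    using iso by (simp_all add: incidence_iso_def)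
  have clos: "\<psi> x \<in> carrier SL2" if "x \<in> carrier SL2" for x
    using bij_betwE[OF bij] that by blast
  define h where "h = \<psi> \<one>\<^bsub>SL2\<^esub>"
  have h: "h \<in> carrier SL2" "inv\<^bsub>SL2\<^esub> h \<in> carrier SL2" using clos by (simp_all add: h_def)
  \<comment> \<open>Restricted to the carrier, because members of \<open>auto\<close> are
    extensional.\<close>
  define \<alpha> where "\<alpha> = (\<lambda>x\<in>carrier SL2. \<psi> x \<otimes>\<^bsub>SL2\<^esub> inv\<^bsub>SL2\<^esub> h)"
  have "bij_betw (\<lambda>y. y \<otimes>\<^bsub>SL2\<^esub> inv\<^bsub>SL2\<^esub> h) (carrier SL2) (carrier SL2)"
    by (rule bij_betw_byWitness[where f' = "\<lambda>y. y \<otimes>\<^bsub>SL2\<^esub> h"]) (use h in \<open>auto simp: SL2.m_assoc\<close>)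
  from bij_betw_trans[OF bij this] have bij_\<alpha>: "bij_betw \<alpha> (carrier SL2) (carrier SL2)"
    by (rule bij_betw_cong[THEN iffD1, rotated]) (simp add: \<alpha>_def)
  have image_\<alpha>: "\<alpha> ` B = \<psi> ` B #>\<^bsub>SL2\<^esub> inv\<^bsub>SL2\<^esub> h" if "B \<subseteq> carrier SL2" for B
  proof -
    have "\<alpha> ` B = (\<lambda>x. \<psi> x \<otimes>\<^bsub>SL2\<^esub> inv\<^bsub>SL2\<^esub> h) ` B"
      using that by (intro image_cong) (auto simp: \<alpha>_def)
    then show ?thesis by (auto simp: r_coset_def)
  qed
  have "(`) \<alpha> ` U.blocks = U'.blocks"
  proof (intro equalityI subsetI)
    fix B assume "B \<in> (`) \<alpha> ` U.blocks"
    then obtain C where C: "C \<in> U.blocks" "B = \<psi> ` C #>\<^bsub>SL2\<^esub> inv\<^bsub>SL2\<^esub> h"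
      using image_\<alpha>[OF U.block_subset] by blast
    then show "B \<in> U'.blocks" using U'.block_r_coset[OF _ h(2)] im by blast
  next
    fix B assume B: "B \<in> U'.blocks"
    then obtain C where C: "C \<in> U.blocks" "B #>\<^bsub>SL2\<^esub> h = \<psi> ` C"
      using U'.block_r_coset[OF B h(1)] im by blast
    have "\<alpha> ` C = B"
      using image_\<alpha>[OF U.block_subset[OF C(1)]] SL2.coset_mult_assoc[OF U'.block_subset[OF B] h]
        SL2.coset_mult_one[OF U'.block_subset[OF B]] h C(2) by simp
    then show "B \<in> (`) \<alpha> ` U.blocks" using C(1) by blast
  qed
  with bij_\<alpha> have iso_\<alpha>: "incidence_iso (SL2_unital p S \<D>) (SL2_unital p S' \<D>') \<alpha>"
    by (simp add: incidence_iso_def)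
  have "\<alpha> \<one>\<^bsub>SL2\<^esub> = \<one>\<^bsub>SL2\<^esub>" using h by (simp add: \<alpha>_def h_def)
  then have "\<alpha> \<in> hom SL2 SL2" "\<alpha> ` S = S'"
    using SL2_unital_iso_fixing_one[OF U U' q3 iso_\<alpha>] by simp_all
  moreover from this have "\<alpha> \<in> auto SL2"
    using bij_\<alpha> by (simp add: auto_def Bij_def \<alpha>_def)
  moreover have "\<psi> x = right_translation SL2 h (\<alpha> x)" if "x \<in> carrier SL2" for x
    using that clos[OF that] h by (simp add: right_translation_def \<alpha>_def SL2.m_assoc)
  ultimately show ?thesis using h(1) by blast
qed

section \<open>The automorphism group as a subgroup\<close>

text \<open>Products and inverses in \<open>BijGroup\<close> are \<open>undefined\<close> outside
  the point set; with blocks inside it, images of blocks can be computed as for unrestricted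
  maps.\<close>

lemma incidence_Aut_subgroup_BijGroup:
  assumes "\<And>B. B \<in> snd U \<Longrightarrow> B \<subseteq> fst U"
  shows "subgroup (incidence_Aut U) (BijGroup (fst U))"
proof (rule subgroup.intro)
  show "incidence_Aut U \<subseteq> carrier (BijGroup (fst U))"
    by (auto simp: incidence_Aut_def incidence_iso_def BijGroup_def Bij_def)
next
  fix f g assume fg: "f \<in> incidence_Aut U" "g \<in> incidence_Aut U"
  then have Bij: "f \<in> Bij (fst U)" "g \<in> Bij (fst U)"
    by (auto simp: incidence_Aut_def incidence_iso_def Bij_def)
  have "compose (fst U) f g ` B = f ` g ` B" if "B \<in> snd U" for B
    unfolding image_image using assms[OF that] by (intro image_cong) (auto simp: compose_def)
  then have "(`) (compose (fst U) f g) ` snd U = (`) f ` (`) g ` snd U"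
    unfolding image_comp by (intro image_cong) (simp_all add: image_image)
  also have "\<dots> = snd U" using fg by (auto simp: incidence_Aut_def incidence_iso_def)
  finally show "f \<otimes>\<^bsub>BijGroup (fst U)\<^esub> g \<in> incidence_Aut U"
    using compose_Bij[OF Bij] Bij
    by (simp add: BijGroup_def incidence_Aut_def incidence_iso_def Bij_def)
next
  have "(\<lambda>x\<in>fst U. x) ` B = B" if "B \<in> snd U" for B using assms[OF that] by force
  then have "(`) (\<lambda>x\<in>fst U. x) ` snd U = snd U" by (metis (no_types, lifting) image_cong image_ident)
  then show "\<one>\<^bsub>BijGroup (fst U)\<^esub> \<in> incidence_Aut U"
    using id_Bij[of "fst U"] by (simp add: BijGroup_def incidence_Aut_def incidence_iso_def Bij_def)
next
  fix f assume f: "f \<in> incidence_Aut U"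
  then have Bij: "f \<in> Bij (fst U)" and im: "(`) f ` snd U = snd U"
    by (auto simp: incidence_Aut_def incidence_iso_def Bij_def)
  let ?g = "\<lambda>x\<in>fst U. inv_into (fst U) f x"
  have inj: "inj_on f (fst U)" using Bij by (simp add: Bij_def bij_betw_def)
  have inverse: "?g ` f ` B = B" if "B \<in> snd U" for B
  proof -
    have "?g (f x) = x" if "x \<in> B" for x
      using inj assms[OF \<open>B \<in> snd U\<close>] that Bij_imp_funcset[OF Bij] by (auto simp: inv_into_f_f)
    then show ?thesis unfolding image_image by simp
  qed
  have "(`) ?g ` snd U = (`) ?g ` (`) f ` snd U" by (simp only: im)
  also have "\<dots> = snd U" unfolding image_image using inverse by (simp only: image_image) simp
  finally show "inv\<^bsub>BijGroup (fst U)\<^esub> f \<in> incidence_Aut U"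
    unfolding inv_BijGroup[OF Bij] using restrict_inv_into_Bij[OF Bij]
    by (simp add: incidence_Aut_def incidence_iso_def Bij_def)
qed

text \<open>Inverses in a structure with restricted carrier are determined by the carrier, so this does
  not presuppose that \<open>K\<close> is a subgroup.\<close>

lemma (in group) subgroup_in_restricted_carrier:
  assumes H: "subgroup H G" and HK: "H \<subseteq> K" and KG: "K \<subseteq> carrier G"
  shows "subgroup H (G\<lparr>carrier := K\<rparr>)"
proof -
  interpret H: subgroup H G by (rule H)
  have "inv\<^bsub>G\<lparr>carrier := K\<rparr>\<^esub> x = inv x" if x: "x \<in> H" for x
    unfolding m_inv_def[of "G\<lparr>carrier := K\<rparr>"]
  proof (rule the_equality)
    show "inv x \<in> carrier (G\<lparr>carrier := K\<rparr>) \<and> x \<otimes>\<^bsub>G\<lparr>carrier := K\<rparr>\<^esub> inv x = \<one>\<^bsub>G\<lparr>carrier := K\<rparr>\<^esub>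
        \<and> inv x \<otimes>\<^bsub>G\<lparr>carrier := K\<rparr>\<^esub> x = \<one>\<^bsub>G\<lparr>carrier := K\<rparr>\<^esub>"
      using H.m_inv_closed[OF x] HK x by auto
  next
    fix y assume "y \<in> carrier (G\<lparr>carrier := K\<rparr>) \<and> x \<otimes>\<^bsub>G\<lparr>carrier := K\<rparr>\<^esub> y = \<one>\<^bsub>G\<lparr>carrier := K\<rparr>\<^esub>
        \<and> y \<otimes>\<^bsub>G\<lparr>carrier := K\<rparr>\<^esub> x = \<one>\<^bsub>G\<lparr>carrier := K\<rparr>\<^esub>"
    then show "y = inv x" using inv_equality[of y x] KG x by auto
  qed
  then show ?thesis using HK by (intro subgroup.intro) auto
qed

theorem mainTheorem3:
  fixes p e q :: nat
    and S S' :: "('a::{field,finite}^2^2) set"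
    and \<D> \<D>' :: "('a^2^2) set set"
  assumes "prime p" and "q = p ^ e" and "q \<ge> 3" and "CARD('a) = q"
    and "affine_SL2_unital p S \<D>" and "affine_SL2_unital p S' \<D>'"
  shows "(\<forall>\<psi>. incidence_iso (SL2_unital p S \<D>) (SL2_unital p S' \<D>') \<psi> \<longrightarrow>
           (\<exists>h \<in> carrier SL2. \<exists>\<alpha> \<in> auto SL2. \<alpha> ` S = S' \<and>
              (\<forall>x \<in> carrier SL2. \<psi> x = right_translation SL2 h (\<alpha> x)))) \<and>
         subgroup (incidence_Aut (SL2_unital p S \<D>)) (auto_translation_group SL2 S)"
proof -
  have U: "SL2_unital_structure p e S \<D>" and U': "SL2_unital_structure p e S' \<D>'"
    and q3: "CARD('a) \<ge> 3"
    using assms by (simp_all add: SL2_unital_structure_def)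
  interpret U: SL2_unital_structure p e S \<D> by (rule U)
  let ?Aut = "incidence_Aut (SL2_unital p S \<D>)"
  let ?K = "{compose (carrier SL2) (right_translation SL2 h) \<alpha> | \<alpha> h.
      \<alpha> \<in> auto_stabilizer SL2 S \<and> h \<in> carrier SL2}"
  have "?Aut \<subseteq> ?K"
  proof
    fix \<psi> assume "\<psi> \<in> ?Aut"
    then have ext: "\<psi> \<in> extensional (carrier SL2)"
      and iso: "incidence_iso (SL2_unital p S \<D>) (SL2_unital p S \<D>) \<psi>"
      by (simp_all add: incidence_Aut_def)
    obtain h \<alpha> where h: "h \<in> carrier SL2" and \<alpha>: "\<alpha> \<in> auto SL2" "\<alpha> ` S = S"
      and eq: "\<And>x. x \<in> carrier SL2 \<Longrightarrow> \<psi> x = right_translation SL2 h (\<alpha> x)"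
      using SL2_unital_iso_decomposition[OF U U q3 iso] by blast
    have "\<psi> = compose (carrier SL2) (right_translation SL2 h) \<alpha>"
      by (rule extensionalityI[OF ext compose_extensional]) (simp add: eq compose_def)
    then show "\<psi> \<in> ?K" using h \<alpha> unfolding auto_stabilizer_def by blast
  qed
  \<comment> \<open>\<open>subgroup_in_restricted_carrier\<close> asks for \<open>?K\<close> to lie
    between the automorphism group and the full permutation group.\<close>
  moreover have "?K \<subseteq> carrier (BijGroup (carrier SL2))"
  proof
    fix f assume "f \<in> ?K"
    then obtain \<alpha> h where f: "f = compose (carrier SL2) (right_translation SL2 h) \<alpha>"
      and \<alpha>: "\<alpha> \<in> auto SL2" and h: "h \<in> carrier SL2" by (auto simp: auto_stabilizer_def)
    have "right_translation SL2 h \<in> Bij (carrier SL2)"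
      unfolding Bij_def right_translation_def using h
      by (auto intro!: bij_betw_byWitness[where f' = "\<lambda>y. y \<otimes>\<^bsub>SL2\<^esub> inv\<^bsub>SL2\<^esub> h"] simp: U.SL2.m_assoc)
    then have "f \<in> Bij (carrier SL2)" using \<alpha> unfolding f by (intro compose_Bij) (auto simp: auto_def)
    then show "f \<in> carrier (BijGroup (carrier SL2))" by (simp add: BijGroup_def)
  qed
  moreover have "subgroup ?Aut (BijGroup (carrier SL2))"
    using incidence_Aut_subgroup_BijGroup[of "SL2_unital p S \<D>"] U.block_subset by simp
  ultimately have "subgroup ?Aut (auto_translation_group SL2 S)"
    unfolding auto_translation_group_def
    by (intro group.subgroup_in_restricted_carrier[OF group_BijGroup])
  then show ?thesis using SL2_unital_iso_decomposition[OF U U' q3] by blast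
qed

end
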